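(* Let $p\in(1,2)$, $\rho>0$, let $\varphi:\mathbb{R}^n\to\mathbb{R}\cup\{+\infty\}$ be proper, lower semicontinuous and convex, let $f:\mathbb{R}^n\to\mathbb{R}\cup\{+\infty\}$ be proper, lower semicontinuous and $(\rho,p)$-paraconvex, and let $F=f+\varphi$. Assume a stochastic subgradient oracle $g$ with constant $L>0$ as described in the context, and let $\{x_t\}$ be generated by the proximal stochastic subgradient method described in the context with positive step sizes $\gamma_t$. Then, for every $0<r<(2\rho)^{-1}$ and every horizon $T\ge0$, $$\mathbb{E}\left[\sum_{t=0}^T\gamma_t\,d\big(0,\partial M_F^r(x_t)\big)^2\right]\le\frac{p}{1-2\rho r}\big(M_F^r(x_0)-\min F\big)+\frac{c_3}{r(1-2\rho r)}\sum_{t=0}^T\gamma_t^{\frac{p}{2-p}}+\frac{c_4L^p}{r(1-2\rho r)}\sum_{t=0}^T\gamma_t^p,$$ where $$c_3=2^{p-1}r^{-\frac{p}{2-p}}+(r^{-1}-2\rho)\,r^{-\frac{2(p-1)}{2-p}},\qquad c_4=2^p(1+2^{p-1}p).$$ In particular, if the step sizes are $\gamma_t=(t+1)^{-1/p}$, then the output $x_{t^*}$ satisfies $$\mathbb{E}\left[d\big(0,\partial M_F^{1/(4\rho)}(x_{t^*})\big)^2\right]\le\frac{c_5\big(M_F^{1/(4\rho)}(x_0)-\min F\big)+c_6}{(T+2)^{1-1/p}-1}+\frac{c_7L^p(\ln(T+1)+1)}{(T+2)^{1-1/p}-1},$$ with $$c_5=2(p-1),\qquad c_6=\frac{8\rho^{\frac{2}{2-p}}}{p}\Big(2^{p-1+\frac{2p}{2-p}}+2^{\frac{3p-2}{2-p}}\Big),\qquad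 c_7=\frac{8\rho(p-1)c_4}{p}.$$
   Context: $\mathbb{R}^n$ is Euclidean space with norm $\|\cdot\|$ and inner product $\langle\cdot,\cdot\rangle$. Paraconvexity: a proper function $f:\mathbb{R}^n\to\mathbb{R}\cup\{+\infty\}$ is $(\rho,p)$-paraconvex if $f(tx+(1-t)y)\le tf(x)+(1-t)f(y)+\frac{\rho}{p}t(1-t)\|x-y\|^p$ for all $x,y\in\mathbb{R}^n$, $t\in[0,1]$. Subdifferentials: the Fréchet subdifferential of $f$ at $x\in\mathrm{dom} f$ is $\widehat\partial f(x)=\{v:\liminf_{y\to x,\,y\ne x}\frac{f(y)-f(x)-\langle v,y-x\rangle}{\|y-x\|}\ge0\}$. The limiting subdifferential $\partial f(x)$ is the set of $v$ for which there exist $x_k\to x$ with $f(x_k)\to f(x)$ and $v_k\in\widehat\partial f(x_k)$ with $v_k\to v$. For a set $S$, $d(0,S)=\inf\{\|v\|:v\in S\}$. Generalized Moreau--Yosida regularization (with kernel $h(t)=t^p/p$): for $r>0$, $M_F^r(x)=\inf_{y\in\mathbb{R}^n}\{F(y)+\frac{1}{rp}\|x-y\|^p\}$. Proximal map: $\mathrm{prox}_{\gamma\varphi}(x)=\arg\min_y\{\varphi(y)+\frac{1}{2\gamma}\|y-x\|^2\}$. Stochastic oracle: $(\Omega,\mathcal{F},\pi)$ is a probability space and $\mathbb{R}^n$ carries its Borel $\sigma$-algebra. (i) One can draw i.i.d. realizations $\xi_0,\xi_1,\dots$ from $\pi$. (ii) There is an open set $U\supset\mathrm{dom}\,\varphi$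 on which $f$ is finite and a measurable $g:U\times\Omega\to\mathbb{R}^n$ with $\mathbb{E}_{\xi\sim\pi}[g(x,\xi)]\in\partial f(x)$ for all $x\in U$. (iii) There is a constant $L>0$ with $\mathbb{E}_{\xi\sim\pi}\|g(x,\xi)\|^p\le L^p$ for all $x\in\mathrm{dom}\,\varphi$. Proximal stochastic subgradient method: given $x_0\in\mathrm{dom}\,\varphi$ and step sizes $\gamma_t>0$, for $t=0,\dots,T$ draw $\xi_t\sim\pi$ (i.i.d.) and set $x_{t+1}=\mathrm{prox}_{\gamma_t\varphi}(x_t-\gamma_tg(x_t,\xi_t))$. Then sample $t^*\in\{0,\dots,T\}$ (independently of the samples $\xi_t$) with $\mathbb{P}(t^*=t)=\gamma_t/\sum_{t'=0}^T\gamma_{t'}$ and output $x_{t^*}$. Expectations are over all randomness. $\min F$ denotes the minimum value of $F$ over $\mathbb{R}^n$, assumed to exist. *)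

theory Defs
  imports "HOL-Probability.Probability"
begin

text \<open>
  Functions \<open>\<real>\<^sup>n \<rightarrow> \<real> \<union> {+\<infinity>}\<close> are modelled as \<^typ>\<open>ereal\<close>-valued functions; the value
  \<open>-\<infinity>\<close> is excluded by properness. In \<^typ>\<open>ereal\<close> one has \<open>0 * \<infinity> = 0\<close>, so the convexity-type
  inequalities below are trivially true at the end points \<open>t = 0\<close> and \<open>t = 1\<close>.
\<close>

definition edom :: "('a \<Rightarrow> ereal) \<Rightarrow> 'a set" where
  "edom f = {x. f x < \<infinity>}"

definition proper :: "('a \<Rightarrow> ereal) \<Rightarrow> bool" where
  "proper f \<longleftrightarrow> (\<forall>x. f x \<noteq> -\<infinity>) \<and> edom f \<noteq> {}"

definition lower_semicontinuous :: "('a::topological_space \<Rightarrow> ereal) \<Rightarrow> bool" where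
  "lower_semicontinuous f \<longleftrightarrow> (\<forall>x. f x \<le> Liminf (at x) f)"

definition convex_fun :: "('a::real_vector \<Rightarrow> ereal) \<Rightarrow> bool" where
  "convex_fun f \<longleftrightarrow> (\<forall>x y. \<forall>t\<in>{0..1}.
     f (t *\<^sub>R x + (1 - t) *\<^sub>R y) \<le> ereal t * f x + ereal (1 - t) * f y)"

definition paraconvex :: "real \<Rightarrow> real \<Rightarrow> ('a::real_normed_vector \<Rightarrow> ereal) \<Rightarrow> bool" where
  "paraconvex \<rho> p f \<longleftrightarrow> proper f \<and> (\<forall>x y. \<forall>t\<in>{0..1}.
     f (t *\<^sub>R x + (1 - t) *\<^sub>R y)
       \<le> ereal t * f x + ereal (1 - t) * f y
         + ereal (\<rho> / p * t * (1 - t) * norm (x - y) powr p))"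

definition frechet_subdiff :: "('a::real_inner \<Rightarrow> ereal) \<Rightarrow> 'a \<Rightarrow> 'a set" where
  "frechet_subdiff f x = {v. x \<in> edom f \<and>
     0 \<le> Liminf (at x) (\<lambda>y. (f y - f x - ereal (v \<bullet> (y - x))) / ereal (norm (y - x)))}"

definition limiting_subdiff :: "('a::real_inner \<Rightarrow> ereal) \<Rightarrow> 'a \<Rightarrow> 'a set" where
  "limiting_subdiff f x = {v. \<exists>xs vs. xs \<longlonglongrightarrow> x \<and> (\<lambda>k. f (xs k)) \<longlonglongrightarrow> f x \<and>
     (\<forall>k. vs k \<in> frechet_subdiff f (xs k)) \<and> vs \<longlonglongrightarrow> v}"

text \<open>
  The distance \<open>d(0, S)\<close>, with the convention \<open>inf \<emptyset> = \<infinity>\<close>. The library's \<^const>\<open>infdist\<close> is not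
  used since it is \<open>0\<close> on the empty set.
\<close>

definition dist_zero :: "'a::real_normed_vector set \<Rightarrow> ennreal" where
  "dist_zero S = (INF v\<in>S. ennreal (norm v))"

definition moreau_env :: "real \<Rightarrow> real \<Rightarrow> ('a::real_normed_vector \<Rightarrow> ereal) \<Rightarrow> 'a \<Rightarrow> ereal" where
  "moreau_env p r F x = (INF y. F y + ereal (norm (x - y) powr p / (r * p)))"

definition prox :: "real \<Rightarrow> ('a::real_normed_vector \<Rightarrow> ereal) \<Rightarrow> 'a \<Rightarrow> 'a" where
  "prox \<gamma> \<phi> x = arg_min (\<lambda>y. \<phi> y + ereal ((norm (y - x))\<^sup>2 / (2 * \<gamma>))) (\<lambda>_. True)"

text \<open>
  Integrability of \<open>g(x, \<cdot>)\<close> is the implicit requirement that the expectation in the unbiasedness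
  condition exists; it has to be explicit because the Bochner integral of a non-integrable
  function is \<open>0\<close>.
\<close>

definition subgradient_oracle ::
  "'o measure \<Rightarrow> 'a::euclidean_space set \<Rightarrow> ('a \<Rightarrow> 'o \<Rightarrow> 'a) \<Rightarrow>
   ('a \<Rightarrow> ereal) \<Rightarrow> ('a \<Rightarrow> ereal) \<Rightarrow> real \<Rightarrow> real \<Rightarrow> bool" where
  "subgradient_oracle \<pi> U g f \<phi> p L \<longleftrightarrow>
     prob_space \<pi> \<and>
     open U \<and> edom \<phi> \<subseteq> U \<and> (\<forall>x\<in>U. \<bar>f x\<bar> \<noteq> \<infinity>) \<and>
     (\<lambda>(x, \<xi>). g x \<xi>) \<in> borel_measurable (restrict_space borel U \<Otimes>\<^sub>M \<pi>) \<and>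
     (\<forall>x\<in>U. integrable \<pi> (g x) \<and> (\<integral>\<xi>. g x \<xi> \<partial>\<pi>) \<in> limiting_subdiff f x) \<and>
     L > 0 \<and>
     (\<forall>x\<in>edom \<phi>. (\<integral>\<^sup>+\<xi>. ennreal (norm (g x \<xi>) powr p) \<partial>\<pi>) \<le> ennreal (L powr p))"

primrec prox_subgrad ::
  "('a::real_normed_vector \<Rightarrow> ereal) \<Rightarrow> ('a \<Rightarrow> 'o \<Rightarrow> 'a) \<Rightarrow> (nat \<Rightarrow> real) \<Rightarrow> 'a \<Rightarrow>
   (nat \<Rightarrow> 'w \<Rightarrow> 'o) \<Rightarrow> nat \<Rightarrow> 'w \<Rightarrow> 'a" where
  "prox_subgrad \<phi> g \<gamma> x\<^sub>0 \<xi> 0 \<omega> = x\<^sub>0"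
| "prox_subgrad \<phi> g \<gamma> x\<^sub>0 \<xi> (Suc t) \<omega> =
     (let x = prox_subgrad \<phi> g \<gamma> x\<^sub>0 \<xi> t \<omega>
      in prox (\<gamma> t) \<phi> (x - \<gamma> t *\<^sub>R g x (\<xi> t \<omega>)))"

text \<open>
  Sampling on a common probability space \<open>P\<close>: \<open>\<xi>\<close> is an i.i.d. sequence with law \<open>\<pi>\<close>, and
  \<open>\<tau>\<close> is a random index in \<open>{0..T}\<close> independent of the whole sequence and distributed
  proportionally to the step sizes. Independence is stated for the generated \<open>\<sigma>\<close>-algebras because
  the library's \<open>indep_var\<close> requires both random variables to have values in the same type.
\<close>

definition iid_samples :: "'w measure \<Rightarrow> 'o measure \<Rightarrow> (nat \<Rightarrow> 'w \<Rightarrow> 'o) \<Rightarrow> bool" where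
  "iid_samples P \<pi> \<xi> \<longleftrightarrow> prob_space P \<and>
     prob_space.indep_vars P (\<lambda>_. \<pi>) \<xi> UNIV \<and> (\<forall>t. distr P \<pi> (\<xi> t) = \<pi>)"

definition output_index ::
  "'w measure \<Rightarrow> 'o measure \<Rightarrow> (nat \<Rightarrow> 'w \<Rightarrow> 'o) \<Rightarrow> (nat \<Rightarrow> real) \<Rightarrow> nat \<Rightarrow> ('w \<Rightarrow> nat) \<Rightarrow> bool" where
  "output_index P \<pi> \<xi> \<gamma> T \<tau> \<longleftrightarrow>
     \<tau> \<in> measurable P (count_space UNIV) \<and>
     prob_space.indep_set P
       (sets (vimage_algebra (space P) \<tau> (count_space UNIV)))
       (sets (vimage_algebra (space P) (\<lambda>\<omega> t. \<xi> t \<omega>) (Pi\<^sub>M UNIV (\<lambda>_. \<pi>)))) \<and>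
     (\<forall>\<omega>\<in>space P. \<tau> \<omega> \<in> {0..T}) \<and>
     (\<forall>t\<in>{0..T}. measure P {\<omega> \<in> space P. \<tau> \<omega> = t} = \<gamma> t / (\<Sum>s=0..T. \<gamma> s))"

end

theory Submission
  imports Defs
begin

text \<open>
  Let \<open>y\<close> minimize \<open>F + |x - \<cdot>|\<^sup>p / (r p)\<close> and put \<open>w = x - y\<close>. For a suitable such \<open>y\<close> the vector
  \<open>grad w = |w|\<^bsup>p-2\<^esup> w / r\<close> is a limiting subgradient of the envelope at \<open>x\<close>, so it suffices to bound
  \<open>|w|\<^bsup>2p-2\<^esup> / r\<^sup>2\<close>. Comparing the optimality conditions of the prox step \<open>x\<^sup>+\<close> and of \<open>y\<close> gives
  \<open>|x\<^sup>+ - y| \<le> |w - \<gamma> grad w - \<gamma> (g - v)|\<close> for some bounded subgradient \<open>v\<close> of \<open>f\<close> at \<open>y\<close>. If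
  \<open>\<gamma> |w|\<^bsup>p-2\<^esup> \<le> r\<close>, then \<open>w - \<gamma> grad w\<close> is a contraction of \<open>w\<close>, and expanding the \<open>p\<close>-th power and
  using paraconvexity yields descent in expectation; otherwise \<open>|w|\<close> is at most a power of \<open>\<gamma>\<close>, which
  accounts for \<open>c\<^sub>3\<close>. The envelope at \<open>x\<^sup>+\<close> is at most \<open>F(y) + |x\<^sup>+ - y|\<^sup>p / (r p)\<close>, so the
  inequality telescopes. Since the distance to the subdifferential need not be measurable, it is
  replaced by the measurable one-step decrease of the envelope before integrating.
\<close>

section \<open>Power inequalities\<close>

text \<open>The bound on r comes from using paraconvexity twice. The subgradient inequality of f at
  y tested at x, and that of the oracle mean at x tested at y, cost (\<rho>/p) |w|^p each, while
  moving along \<open>grad w\<close> gains 1/r; the balance is \<open>\<kappa>\<close> = 1/r - 2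
  \<rho>. The main obstacle is that v depends on the prox point, hence on the random subgradient u,
  and must disappear before expectations are taken. Its inner product with w is therefore bounded by
  a quantity free of u, and in the remainder only |v| <= L is used. Since p < 2, the expansion of |w
  + h|^p has a remainder of order |h|^p instead of |h|^2; this explains the p-th moment of the
  oracle and the powers \<gamma>^p. Moreover |w|^(p-2) is unbounded near w = 0, so a step along
  \<open>grad w\<close> can overshoot the minimizer, which forces the case distinction. Minimizers
  may fail to be unique. Descent is proved for every minimizer, so that it applies to the one whose
  \<open>grad\<close> is a limiting subgradient.\<close>

lemma powr_le_tangent:
  fixes X Y q :: real
  assumes "0 \<le> X" "0 < Y" "0 < q" "q < 1"
  shows "X powr q \<le> Y powr q + q * Y powr (q - 1) * (X - Y)"
proof -
  have Yq: "Y powr (q - 1) * Y = Y powr q"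
    using assms by (simp add: powr_diff)
  show ?thesis
  proof (cases "X = 0")
    case True
    have "q * Y powr q \<le> Y powr q" using assms by simp
    with True Yq show ?thesis using assms by (simp add: algebra_simps)
  next
    case False
    \<comment> \<open>The tangent inequality is weighted AM-GM for X and Y, multiplied by
      \<open>Y powr (q - 1)\<close>.\<close>
    have "X powr q * Y powr (1 - q) \<le> q * X + (1 - q) * Y"
      using Youngs_inequality_0[of q "1 - q" X Y] False assms by simp
    then have "X powr q * Y powr (1 - q) * Y powr (q - 1) \<le> (q * X + (1 - q) * Y) * Y powr (q - 1)"
      by (intro mult_right_mono) auto
    moreover have "Y powr (1 - q) * Y powr (q - 1) = 1"
      using assms by (simp add: powr_add[symmetric])
    ultimately have "X powr q \<le> q * X * Y powr (q - 1) + (1 - q) * (Y powr (q - 1) * Y)"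
      by (simp add: mult.assoc algebra_simps)
    also have "\<dots> = Y powr (q - 1) * Y + q * Y powr (q - 1) * (X - Y)"
      by (simp add: algebra_simps)
    finally show ?thesis using Yq by simp
  qed
qed

lemma powr_add_le:
  fixes x y p :: real
  assumes "0 \<le> x" "0 \<le> y" "1 \<le> p"
  shows "(x + y) powr p \<le> 2 powr (p - 1) * (x powr p + y powr p)"
proof -
  have key: "x = 0 \<or> y = 0 \<Longrightarrow> ?thesis"
  proof -
    assume "x = 0 \<or> y = 0"
    moreover have "1 \<le> 2 powr (p - 1)" using assms by (simp add: ge_one_powr_ge_zero)
    then have "1 * (x powr p + y powr p) \<le> 2 powr (p - 1) * (x powr p + y powr p)"
      by (intro mult_right_mono) auto
    ultimately show ?thesis using assms by auto
  qed
  show ?thesis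
  proof (cases "x = 0 \<or> y = 0")
    case False
    then have pos: "x > 0" "y > 0" using assms by auto
    have "((1 / 2) *\<^sub>R x + (1 / 2) *\<^sub>R y) powr p \<le> (1 / 2) * x powr p + (1 / 2) * y powr p"
      using convex_onD[OF powr_convex[OF assms(3)], of "1 / 2" x y] pos by simp
    moreover have "(1 / 2) *\<^sub>R x + (1 / 2) *\<^sub>R y = (x + y) / 2"
      by simp
    moreover have "((x + y) / 2) powr p = (x + y) powr p / 2 powr p"
      using pos by (simp add: powr_divide)
    ultimately have "(x + y) powr p / 2 powr p \<le> (1 / 2) * x powr p + (1 / 2) * y powr p"
      by metis
    then have "(x + y) powr p \<le> 2 powr p * ((1 / 2) * x powr p + (1 / 2) * y powr p)"
      by (simp add: pos_divide_le_eq mult.commute)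
    then show ?thesis by (simp add: powr_diff field_simps)
  qed (use key in auto)
qed

text \<open>The squared norm is exactly quadratic, and t^(p/2) lies below each of its tangents. If
  |z| <= 2|u|, the tangent at |u|^2 gives the linear term and leaves |u|^(p-2) |z|^2, which is at
  most 2 |z|^p. Otherwise the tangent at (|z| - |u|)^2 is taken: its slope multiplies the
  nonnegative number \<open>u \<bullet> z\<close> + |u||z|, so it may be enlarged to the slope at
  |u|^2.\<close>

lemma norm_add_powr_le:
  fixes u z :: "'a::real_inner" and p :: real
  assumes p: "1 < p" "p < 2"
  shows "norm (u + z) powr p \<le> norm u powr p + p * norm u powr (p - 2) * (u \<bullet> z)
           + (1 + p) * norm z powr p"
proof (cases "u = 0")
  case False
  define a b s where "a = norm u" and "b = norm z" and "s = u \<bullet> z"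
  have a: "a > 0" and b: "b \<ge> 0" using False by (auto simp: a_def b_def)
  have s: "\<bar>s\<bar> \<le> a * b" unfolding a_def b_def s_def by (rule Cauchy_Schwarz_ineq2)
  have sq: "(norm (u + z))\<^sup>2 = a\<^sup>2 + 2 * s + b\<^sup>2"
    by (simp add: power2_norm_eq_inner a_def b_def s_def algebra_simps inner_commute)
  have pw: "(t\<^sup>2) powr c = t powr (2 * c)" if "t \<ge> 0" for t c :: real
    using that by (cases "t = 0") (simp_all add: powr_powr powr_numeral[symmetric] del: powr_numeral)
  have lhs: "norm (u + z) powr p = (a\<^sup>2 + 2 * s + b\<^sup>2) powr (p / 2)"
    using pw[of "norm (u + z)" "p / 2"] by (simp add: sq)
  have nn: "0 \<le> a\<^sup>2 + 2 * s + b\<^sup>2" by (metis sq zero_le_power2)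
  have tangent: "norm (u + z) powr p \<le> c powr p + p / 2 * c powr (p - 2) * (a\<^sup>2 + 2 * s + b\<^sup>2 - c\<^sup>2)"
    if "c > 0" for c
    using powr_le_tangent[OF nn, of "c\<^sup>2" "p / 2"] that p
    by (simp add: lhs pw algebra_simps)
  show ?thesis
  proof (cases "b \<le> 2 * a")
    case True
    have t: "norm (u + z) powr p \<le> a powr p + p / 2 * a powr (p - 2) * (2 * s + b\<^sup>2)"
      using tangent[OF a] by (simp add: algebra_simps)
    have "a powr (p - 2) * b\<^sup>2 \<le> 2 * b powr p"
    proof (cases "b = 0")
      case False
      have "a powr (p - 2) \<le> (b / 2) powr (p - 2)"
        using True False a b p by (intro powr_mono2') auto
      also have "\<dots> = 2 powr (2 - p) * b powr (p - 2)"
        using b by (simp add: powr_divide powr_diff)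
      also have "\<dots> \<le> 2 * b powr (p - 2)"
        using p powr_mono[of "2 - p" 1 "2::real"] by (intro mult_right_mono) auto
      finally have "a powr (p - 2) * b\<^sup>2 \<le> 2 * b powr (p - 2) * b\<^sup>2"
        by (intro mult_right_mono) auto
      also have "\<dots> = 2 * b powr p" using False b by (simp add: powr_diff)
      finally show ?thesis .
    qed simp
    then have "p / 2 * (a powr (p - 2) * b\<^sup>2) \<le> p / 2 * (2 * b powr p)"
      using p by (intro mult_left_mono) auto
    then have "p / 2 * (a powr (p - 2) * b\<^sup>2) \<le> (1 + p) * b powr p"
      by (simp add: algebra_simps) (smt (verit) powr_ge_zero)
    moreover have "p / 2 * a powr (p - 2) * (2 * s + b\<^sup>2)
        = p * a powr (p - 2) * s + p / 2 * (a powr (p - 2) * b\<^sup>2)"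
      by (simp add: field_simps)
    ultimately show ?thesis using t
      unfolding a_def[symmetric] b_def[symmetric] s_def[symmetric] by linarith
  next
    case False
    have t: "norm (u + z) powr p \<le> (b - a) powr p + p * ((b - a) powr (p - 2) * (s + a * b))"
    proof -
      have "a\<^sup>2 + 2 * s + b\<^sup>2 - (b - a)\<^sup>2 = 2 * (s + a * b)"
        by (simp add: power2_diff algebra_simps)
      with tangent[of "b - a"] have "norm (u + z) powr p
          \<le> (b - a) powr p + p / 2 * (b - a) powr (p - 2) * (2 * (s + a * b))"
        using False a by simp
      then show ?thesis by (simp add: field_simps)
    qed
    have "(b - a) powr (p - 2) * (s + a * b) \<le> a powr (p - 2) * (s + a * b)"
      using s False a p by (intro mult_right_mono powr_mono2') auto
    then have "p * ((b - a) powr (p - 2) * (s + a * b)) \<le> p * (a powr (p - 2) * (s + a * b))"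
      using p by (intro mult_left_mono) auto
    moreover have "(b - a) powr p \<le> b powr p"
      using False a p by (intro powr_mono2) auto
    moreover have "a powr (p - 2) * a \<le> b powr (p - 1)"
    proof -
      have "a powr (p - 2) * a = a powr (p - 1)" using a by (simp add: powr_diff power2_eq_square)
      also have "\<dots> \<le> b powr (p - 1)" using False a p by (intro powr_mono2) auto
      finally show ?thesis .
    qed
    then have "a powr (p - 2) * a * b \<le> b powr (p - 1) * b"
      using b by (intro mult_right_mono)
    then have "p * (a powr (p - 2) * a * b) \<le> p * b powr p"
      using p False a by (intro mult_left_mono) (auto simp: powr_diff)
    ultimately show ?thesis using t
      unfolding a_def[symmetric] b_def[symmetric] s_def[symmetric]
      by (simp add: algebra_simps) (smt (verit) powr_ge_zero)
  qed
qed (use p mult_right_mono[of 1 "1 + p" "norm z powr p"] in simp)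

section \<open>Functions with closed epigraph and the proximal map\<close>

text \<open>An extended-valued function is represented by its domain and a real function on it.
  Closedness of this set is lower semicontinuity of the extension by +\<infinity>, also at boundary
  points outside \<open>D\<close>.\<close>

definition epi :: "'a set \<Rightarrow> ('a \<Rightarrow> real) \<Rightarrow> ('a \<times> real) set" where
  "epi D G = {(x, c). x \<in> D \<and> G x \<le> c}"

lemma closed_epi_limit:
  fixes D :: "'a::first_countable_topology set"
  assumes "closed (epi D G)" "\<And>k. y k \<in> D" "y \<longlonglongrightarrow> l" "\<And>k. G (y k) \<le> c k" "c \<longlonglongrightarrow> c'"
  shows "l \<in> D \<and> G l \<le> c'"
proof -
  have "(\<lambda>k. (y k, c k)) \<longlonglongrightarrow> (l, c')" using assms(3,5) by (rule tendsto_Pair)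
  moreover have "\<forall>k. (y k, c k) \<in> epi D G" using assms by (simp add: epi_def)
  ultimately have "(l, c') \<in> epi D G"
    using closed_sequentially[OF assms(1), of "\<lambda>k. (y k, c k)" "(l, c')"] by simp
  then show ?thesis by (simp add: epi_def)
qed

lemma closed_epi_add_continuous:
  assumes "closed (epi D G)" "continuous_on UNIV q"
  shows "closed (epi D (\<lambda>x. G x + q x))"
proof -
  have "epi D (\<lambda>x. G x + q x) = (\<lambda>z. (fst z, snd z - q (fst z))) -` epi D G"
    by (auto simp: epi_def)
  moreover have "continuous_on UNIV (\<lambda>z. (fst z, snd z - q (fst z)))"
    by (intro continuous_intros continuous_on_compose2[OF assms(2)]) auto
  ultimately show ?thesis using assms(1) by (simp add: closed_vimage)
qed

lemma closed_epi_restrict: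
  assumes "closed (epi D G)" "closed C"
  shows "closed (epi (D \<inter> C) G)"
proof -
  have "epi (D \<inter> C) G = epi D G \<inter> (C \<times> UNIV)" by (auto simp: epi_def)
  then show ?thesis using assms by (simp add: closed_Int closed_Times)
qed

lemma closed_sublevel:
  fixes D :: "'a::first_countable_topology set"
  assumes "closed (epi D G)"
  shows "closed {y \<in> D. G y \<le> c}"
  unfolding closed_sequential_limits
  using closed_epi_limit[OF assms, of _ _ "\<lambda>_. c" c] by auto

text \<open>The sublevel sets at the values of \<open>G\<close> below \<open>G z\<close> are
  nonempty, compact and nested, so they have a common point, and it minimizes. This way no lower
  bound for \<open>G\<close> has to be known beforehand.\<close>

lemma closed_epi_attains_min:
  fixes D :: "'a::heine_borel set"
  assumes "closed (epi D G)" "z \<in> D" "bounded {y \<in> D. G y \<le> G z}"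
  obtains y where "y \<in> D" "\<And>y'. y' \<in> D \<Longrightarrow> G y \<le> G y'"
proof -
  let ?F = "(\<lambda>w. {y \<in> D. G y \<le> G w}) ` {w \<in> D. G w \<le> G z}"
  have "\<Inter> ?F \<noteq> {}"
  proof (rule compact_chain)
    fix S assume "S \<in> ?F"
    then obtain w where w: "w \<in> D" "G w \<le> G z" "S = {y \<in> D. G y \<le> G w}" by auto
    have "S \<subseteq> {y \<in> D. G y \<le> G z}" using w by auto
    then show "compact S"
      using assms(3) closed_sublevel[OF assms(1)] w(3) bounded_subset
      by (auto simp: compact_eq_bounded_closed)
  next
    fix S T assume "S \<in> ?F \<and> T \<in> ?F"
    then obtain w v where "S = {y \<in> D. G y \<le> G w}" "T = {y \<in> D. G y \<le> G v}" by auto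
    then show "S \<subseteq> T \<or> T \<subseteq> S" by (cases "G w \<le> G v") auto
  qed auto
  then obtain y where y: "\<And>w. w \<in> D \<Longrightarrow> G w \<le> G z \<Longrightarrow> y \<in> D \<and> G y \<le> G w" by blast
  have "G y \<le> G w" if "w \<in> D" for w
    using y[of z] y[of w] assms(2) that by linarith
  with y[of z] assms(2) show ?thesis by (intro that) auto
qed

lemma closed_epi_bounded_below_ball:
  fixes D :: "'a::heine_borel set"
  assumes "closed (epi D G)" "z \<in> D" "0 \<le> R"
  obtains K where "\<And>y. y \<in> D \<Longrightarrow> dist z y \<le> R \<Longrightarrow> K \<le> G y"
proof -
  have "bounded {y \<in> D \<inter> cball z R. G y \<le> G z}"
    by (rule bounded_subset[OF bounded_cball, of _ z R]) auto
  from closed_epi_attains_min[OF closed_epi_restrict[OF assms(1) closed_cball] _ this] assms(2,3)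
  obtain y where "\<And>y'. y' \<in> D \<inter> cball z R \<Longrightarrow> G y \<le> G y'" by auto
  then show ?thesis by (intro that[of "G y"]) auto
qed

text \<open>The definition uses the punctured filter \<open>at x\<close>, while a sequence may hit
  its limit; the inequality at \<open>l\<close> itself is added by hand to pass to
  \<open>nhds\<close>.\<close>

lemma lower_semicontinuous_liminf:
  fixes f :: "'a::first_countable_topology \<Rightarrow> ereal"
  assumes "lower_semicontinuous f" "X \<longlonglongrightarrow> l"
  shows "f l \<le> liminf (\<lambda>k. f (X k))"
  unfolding le_Liminf_iff
proof (intro allI impI)
  fix y assume y: "y < f l"
  then have "y < Liminf (at l) f"
    using assms(1) unfolding lower_semicontinuous_def by (metis less_le_trans)
  then have "eventually (\<lambda>x. y < f x) (at l)" by (rule less_LiminfD)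
  then have "eventually (\<lambda>x. y < f x) (nhds l)"
    using y by (auto simp: eventually_at_filter elim: eventually_mono)
  then show "eventually (\<lambda>k. y < f (X k)) sequentially"
    using assms(2) by (rule eventually_compose_filterlim)
qed

lemma closed_epi_liminf:
  fixes f :: "'a::first_countable_topology \<Rightarrow> ereal"
  assumes "\<And>X l. X \<longlonglongrightarrow> l \<Longrightarrow> f l \<le> liminf (\<lambda>k. f (X k))" "\<And>x. f x \<noteq> -\<infinity>"
  shows "closed (epi (edom f) (\<lambda>x. real_of_ereal (f x)))"
proof -
  have epi: "(x, c) \<in> epi (edom f) (\<lambda>x. real_of_ereal (f x)) \<longleftrightarrow> f x \<le> ereal c" for x c
    using assms(2)[of x] by (cases "f x") (auto simp: epi_def edom_def)
  show ?thesis unfolding closed_sequential_limits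
  proof (intro allI impI, elim conjE)
    fix z l assume z: "\<forall>n. z n \<in> epi (edom f) (\<lambda>x. real_of_ereal (f x))" "z \<longlonglongrightarrow> l"
    have l1: "(\<lambda>n. fst (z n)) \<longlonglongrightarrow> fst l" "(\<lambda>n. ereal (snd (z n))) \<longlonglongrightarrow> ereal (snd l)"
      using z(2) by (auto intro!: tendsto_fst tendsto_snd)
    have "f (fst l) \<le> liminf (\<lambda>n. f (fst (z n)))" using assms(1) l1(1) by blast
    also have "\<dots> \<le> liminf (\<lambda>n. ereal (snd (z n)))"
      using z(1) epi by (intro Liminf_mono always_eventually allI) (metis prod.collapse)
    also have "\<dots> = ereal (snd l)" by (rule lim_imp_Liminf[OF _ l1(2)]) simp
    finally show "l \<in> epi (edom f) (\<lambda>x. real_of_ereal (f x))"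
      using epi[of "fst l" "snd l"] by simp
  qed
qed

lemma liminf_add_lower_semicontinuous:
  fixes f h :: "'a::first_countable_topology \<Rightarrow> ereal"
  assumes "lower_semicontinuous f" "lower_semicontinuous h"
    and "\<And>x. f x \<noteq> -\<infinity>" "\<And>x. h x \<noteq> -\<infinity>" "X \<longlonglongrightarrow> l"
  shows "f l + h l \<le> liminf (\<lambda>k. f (X k) + h (X k))"
proof -
  have 1: "f l \<le> liminf (\<lambda>k. f (X k))" "h l \<le> liminf (\<lambda>k. h (X k))"
    using assms lower_semicontinuous_liminf by blast+
  then have "f l + h l \<le> liminf (\<lambda>k. f (X k)) + liminf (\<lambda>k. h (X k))"
    by (rule add_mono)
  also have "\<dots> \<le> liminf (\<lambda>k. f (X k) + h (X k))"
    using 1 assms(3)[of l] assms(4)[of l] by (intro ereal_liminf_add_mono) auto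
  finally show ?thesis .
qed

lemma norm_add_scaleR_power2:
  "(norm (a + t *\<^sub>R b))\<^sup>2 = (norm a)\<^sup>2 + 2 * t * (a \<bullet> b) + t\<^sup>2 * (norm b)\<^sup>2"
  for a b :: "'a::real_inner"
  by (simp add: power2_norm_eq_inner inner_add_left inner_add_right inner_commute)
    (simp add: power2_eq_square)

section \<open>The proximal map of a lower semicontinuous convex function\<close>

locale proper_lsc_convex =
  fixes \<phi> :: "'a::euclidean_space \<Rightarrow> ereal"
  assumes proper: "proper \<phi>" and lsc: "lower_semicontinuous \<phi>" and cvx: "convex_fun \<phi>"
begin

definition \<phi>r :: "'a \<Rightarrow> real" where "\<phi>r x = real_of_ereal (\<phi> x)"

lemma \<phi>_eq: "x \<in> edom \<phi> \<Longrightarrow> \<phi> x = ereal (\<phi>r x)"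
  using proper by (cases "\<phi> x") (auto simp: proper_def edom_def \<phi>r_def)

lemma \<phi>_outside: "x \<notin> edom \<phi> \<Longrightarrow> \<phi> x = \<infinity>"
  by (simp add: edom_def)

lemma closed_epi: "closed (epi (edom \<phi>) \<phi>r)"
  using closed_epi_liminf[of \<phi>] lower_semicontinuous_liminf[OF lsc] proper
  by (simp add: \<phi>r_def[abs_def] proper_def)

lemma convexD:
  assumes "x \<in> edom \<phi>" "y \<in> edom \<phi>" "0 \<le> t" "t \<le> 1"
  shows "t *\<^sub>R x + (1 - t) *\<^sub>R y \<in> edom \<phi>"
    and "\<phi>r (t *\<^sub>R x + (1 - t) *\<^sub>R y) \<le> t * \<phi>r x + (1 - t) * \<phi>r y"
proof -
  have "\<phi> (t *\<^sub>R x + (1 - t) *\<^sub>R y) \<le> ereal t * \<phi> x + ereal (1 - t) * \<phi> y"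
    using cvx assms unfolding convex_fun_def by auto
  also have "\<dots> = ereal (t * \<phi>r x + (1 - t) * \<phi>r y)" using assms by (simp add: \<phi>_eq)
  finally have *: "\<phi> (t *\<^sub>R x + (1 - t) *\<^sub>R y) \<le> ereal (t * \<phi>r x + (1 - t) * \<phi>r y)" .
  then show **: "t *\<^sub>R x + (1 - t) *\<^sub>R y \<in> edom \<phi>" by (auto simp: edom_def)
  show "\<phi>r (t *\<^sub>R x + (1 - t) *\<^sub>R y) \<le> t * \<phi>r x + (1 - t) * \<phi>r y"
    using * \<phi>_eq[OF **] by simp
qed

text \<open>A weak form of the affine minorant that avoids separation theorems.
  \<open>\<phi>r\<close> is bounded below on the unit ball around \<open>z\<close>; for
  \<open>y\<close> farther away, convexity on the segment from \<open>z\<close> to \<open>y\<close>,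
  at its point at distance 1 from \<open>z\<close>, carries this bound to \<open>y\<close> with
  linear growth.\<close>

lemma linear_lower_bound:
  assumes z: "z \<in> edom \<phi>"
  obtains K where "0 \<le> K" "\<And>y. y \<in> edom \<phi> \<Longrightarrow> - K * (1 + norm (y - z)) \<le> \<phi>r y"
proof -
  obtain k where k: "\<And>y. y \<in> edom \<phi> \<Longrightarrow> dist z y \<le> 1 \<Longrightarrow> k \<le> \<phi>r y"
    using closed_epi_bounded_below_ball[OF closed_epi z, of 1] by auto
  define K where "K = \<bar>k\<bar> + \<bar>\<phi>r z\<bar>"
  have K: "0 \<le> K" by (simp add: K_def)
  have "- K * (1 + norm (y - z)) \<le> \<phi>r y" if y: "y \<in> edom \<phi>" for y
  proof (cases "norm (y - z) \<le> 1")
    case True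
    then have "k \<le> \<phi>r y" using k[OF y] by (simp add: dist_norm norm_minus_commute)
    moreover have "K \<le> K * (1 + norm (y - z))"
      using K mult_left_mono[of 1 "1 + norm (y - z)" K] by simp
    moreover have "- k \<le> K" by (simp add: K_def)
    ultimately show ?thesis by simp
  next
    case False
    define s where "s = norm (y - z)"
    have s: "1 < s" using False by (simp add: s_def)
    define q where "q = (1 / s) *\<^sub>R y + (1 - 1 / s) *\<^sub>R z"
    have q: "q \<in> edom \<phi>" "\<phi>r q \<le> (1 / s) * \<phi>r y + (1 - 1 / s) * \<phi>r z"
      using convexD[OF y z, of "1 / s"] s by (auto simp: q_def)
    have "q - z = (1 / s) *\<^sub>R (y - z)" by (simp add: q_def algebra_simps)
    then have "norm (q - z) = 1" using s by (auto simp: s_def)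
    then have "k \<le> \<phi>r q" using k[OF q(1)] by (simp add: dist_norm norm_minus_commute)
    then have "s * k \<le> s * ((1 / s) * \<phi>r y + (1 - 1 / s) * \<phi>r z)"
      using q(2) s by (intro mult_left_mono) auto
    also have "\<dots> = \<phi>r y + (s - 1) * \<phi>r z" using s by (simp add: field_simps)
    finally have *: "s * k \<le> \<phi>r y + (s - 1) * \<phi>r z" .
    have "- \<bar>k\<bar> * s \<le> s * k" using s by (simp add: abs_if)
    moreover have "(s - 1) * \<phi>r z \<le> (s - 1) * \<bar>\<phi>r z\<bar>" using s by (intro mult_left_mono) auto
    ultimately have "- \<bar>k\<bar> * s - (s - 1) * \<bar>\<phi>r z\<bar> \<le> \<phi>r y" using * by linarith
    moreover have "0 \<le> \<bar>k\<bar> + 2 * \<bar>\<phi>r z\<bar>" by simp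
    ultimately show ?thesis by (simp add: K_def s_def[symmetric] algebra_simps)
  qed
  with K show ?thesis by (rule that)
qed

context
  fixes \<gamma> :: real and z :: 'a
  assumes \<gamma>: "0 < \<gamma>"
begin

lemma prox_objective_attains_min:
  obtains y where "y \<in> edom \<phi>"
    "\<And>y'. y' \<in> edom \<phi> \<Longrightarrow> \<phi>r y + (norm (y - z))\<^sup>2 / (2 * \<gamma>) \<le> \<phi>r y' + (norm (y' - z))\<^sup>2 / (2 * \<gamma>)"
proof -
  obtain w where w: "w \<in> edom \<phi>" using proper by (auto simp: proper_def)
  let ?G = "\<lambda>y. \<phi>r y + (norm (y - z))\<^sup>2 / (2 * \<gamma>)"
  have cl: "closed (epi (edom \<phi>) ?G)"
    by (intro closed_epi_add_continuous[OF closed_epi] continuous_intros) (use \<gamma> in auto)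
  obtain K where K: "0 \<le> K" "\<And>y. y \<in> edom \<phi> \<Longrightarrow> - K * (1 + norm (y - w)) \<le> \<phi>r y"
    using linear_lower_bound[OF w] by blast
  have "bounded {y \<in> edom \<phi>. ?G y \<le> ?G w}"
    unfolding bounded_iff
  proof (intro exI ballI)
    fix y assume "y \<in> {y \<in> edom \<phi>. ?G y \<le> ?G w}"
    then have y: "y \<in> edom \<phi>" "?G y \<le> ?G w" by auto
    define s c where "s = norm (y - z)" and "c = \<bar>?G w\<bar> + K * (1 + norm (w - z))"
    have c: "0 \<le> c" using K by (simp add: c_def)
    have "norm (y - w) \<le> s + norm (w - z)"
      unfolding s_def using norm_triangle_ineq4[of "y - z" "w - z"] by simp
    then have "K * (1 + norm (y - w)) \<le> K * (1 + (s + norm (w - z)))"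
      using K by (intro mult_left_mono) auto
    then have "s\<^sup>2 / (2 * \<gamma>) \<le> c + K * s"
      using y(2) K(2)[OF y(1)] unfolding c_def s_def by (simp add: algebra_simps)
    then have sq: "s * s \<le> 2 * \<gamma> * (c + K * s)"
      using \<gamma> by (simp add: field_simps power2_eq_square)
    \<comment> \<open>The quadratic term beats the linear minorant: for s > 1 one has c + K s <= (c
      + K) s, and dividing \<open>sq\<close> by s bounds s.\<close>
    have "s \<le> 1 + 2 * \<gamma> * (c + K)"
    proof (rule ccontr)
      assume "\<not> ?thesis"
      moreover have "0 \<le> 2 * \<gamma> * (c + K)" using \<gamma> c K by simp
      ultimately have s1: "1 < s" and s2: "2 * \<gamma> * (c + K) < s" by auto
      have "c + K * s \<le> (c + K) * s"
        using s1 c mult_left_mono[of 1 s c] by (simp add: algebra_simps)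
      then have "2 * \<gamma> * (c + K * s) \<le> 2 * \<gamma> * ((c + K) * s)"
        using \<gamma> by (intro mult_left_mono) auto
      also have "\<dots> < s * s" using s2 s1 mult_strict_right_mono[OF s2, of s] by (simp add: mult.assoc)
      finally show False using sq by simp
    qed
    then show "norm y \<le> norm z + (1 + 2 * \<gamma> * (\<bar>?G w\<bar> + K * (1 + norm (w - z)) + K))"
      using norm_triangle_ineq[of z "y - z"] by (simp add: s_def c_def)
  qed
  from closed_epi_attains_min[OF cl w this] that show ?thesis by blast
qed

lemma prox_is_minimizer:
  shows prox_in: "prox \<gamma> \<phi> z \<in> edom \<phi>"
    and "y \<in> edom \<phi> \<Longrightarrow> \<phi>r (prox \<gamma> \<phi> z) + (norm (prox \<gamma> \<phi> z - z))\<^sup>2 / (2 * \<gamma>)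
           \<le> \<phi>r y + (norm (y - z))\<^sup>2 / (2 * \<gamma>)"
proof -
  let ?H = "\<lambda>y. \<phi> y + ereal ((norm (y - z))\<^sup>2 / (2 * \<gamma>))"
  obtain w where w: "w \<in> edom \<phi>"
    "\<And>y. y \<in> edom \<phi> \<Longrightarrow> \<phi>r w + (norm (w - z))\<^sup>2 / (2 * \<gamma>) \<le> \<phi>r y + (norm (y - z))\<^sup>2 / (2 * \<gamma>)"
    using prox_objective_attains_min by blast
  have "\<not> ?H y < ?H w" for y
    using w(2)[of y] by (cases "y \<in> edom \<phi>") (auto simp: \<phi>_eq \<phi>_outside w(1))
  then have "is_arg_min ?H (\<lambda>_. True) w" by (auto simp: is_arg_min_def)
  \<comment> \<open>\<open>arg_min\<close> is a choice operator and meets its specification only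
    because the minimizer \<open>w\<close> has been exhibited.\<close>
  then have "is_arg_min ?H (\<lambda>_. True) (prox \<gamma> \<phi> z)"
    unfolding prox_def arg_min_def by (rule someI)
  then have m: "?H (prox \<gamma> \<phi> z) \<le> ?H y" for y
    by (auto simp: is_arg_min_def not_less)
  show in_dom: "prox \<gamma> \<phi> z \<in> edom \<phi>"
    using m[of w] by (cases "prox \<gamma> \<phi> z \<in> edom \<phi>") (auto simp: \<phi>_eq[OF w(1)] \<phi>_outside)
  show "y \<in> edom \<phi> \<Longrightarrow> \<phi>r (prox \<gamma> \<phi> z) + (norm (prox \<gamma> \<phi> z - z))\<^sup>2 / (2 * \<gamma>)
           \<le> \<phi>r y + (norm (y - z))\<^sup>2 / (2 * \<gamma>)"
    using m[of y] by (simp add: \<phi>_eq in_dom)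
qed

text \<open>This expresses that (z - q)/\<gamma> is a convex subgradient of \<phi> at the prox point
  q. Moving from q towards \<open>y\<close> by the fraction t changes the square only to first order
  in t, up to an error of order t^2; dividing by t and letting t tend to 0 leaves the
  inequality.\<close>

lemma prox_variational:
  assumes y: "y \<in> edom \<phi>"
  shows "(z - prox \<gamma> \<phi> z) \<bullet> (y - prox \<gamma> \<phi> z) \<le> \<gamma> * (\<phi>r y - \<phi>r (prox \<gamma> \<phi> z))"
proof -
  define q where "q = prox \<gamma> \<phi> z"
  have q: "q \<in> edom \<phi>" using prox_in by (simp add: q_def)
  let ?A = "(z - q) \<bullet> (y - q) - \<gamma> * (\<phi>r y - \<phi>r q)"
  have *: "?A \<le> t * (norm (y - q))\<^sup>2 / 2" if t: "0 < t" "t \<le> 1" for t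
  proof -
    define v where "v = t *\<^sub>R y + (1 - t) *\<^sub>R q"
    have v: "v \<in> edom \<phi>" "\<phi>r v \<le> t * \<phi>r y + (1 - t) * \<phi>r q"
      using convexD[OF y q, of t] t by (auto simp: v_def)
    have vz: "v - z = (q - z) + t *\<^sub>R (y - q)" by (simp add: v_def algebra_simps)
    have e: "(norm (v - z))\<^sup>2 = (norm (q - z))\<^sup>2 - 2 * t * ((z - q) \<bullet> (y - q)) + t\<^sup>2 * (norm (y - q))\<^sup>2"
    proof -
      have "(q - z) \<bullet> (y - q) = - ((z - q) \<bullet> (y - q))" by (simp add: inner_diff_left)
      then show ?thesis
        unfolding vz norm_add_scaleR_power2 by simp
    qed
    have "\<phi>r q + (norm (q - z))\<^sup>2 / (2 * \<gamma>) \<le> \<phi>r v + (norm (v - z))\<^sup>2 / (2 * \<gamma>)"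
      unfolding q_def by (rule prox_is_minimizer(2)[OF v(1)])
    also have "\<dots> \<le> t * \<phi>r y + (1 - t) * \<phi>r q + (norm (v - z))\<^sup>2 / (2 * \<gamma>)"
      using v(2) by simp
    finally have "2 * \<gamma> * (\<phi>r q + (norm (q - z))\<^sup>2 / (2 * \<gamma>))
        \<le> 2 * \<gamma> * (t * \<phi>r y + (1 - t) * \<phi>r q + (norm (v - z))\<^sup>2 / (2 * \<gamma>))"
      using \<gamma> by (intro mult_left_mono) auto
    then have "2 * \<gamma> * \<phi>r q + (norm (q - z))\<^sup>2
        \<le> 2 * \<gamma> * (t * \<phi>r y + (1 - t) * \<phi>r q) + (norm (v - z))\<^sup>2"
      using \<gamma> by (simp add: distrib_left)
    then have "2 * t * ?A \<le> 2 * t * (t * (norm (y - q))\<^sup>2 / 2)"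
      unfolding e by (simp add: algebra_simps power2_eq_square)
    then show ?thesis using t by simp
  qed
  have "((\<lambda>t. t * (norm (y - q))\<^sup>2 / 2) \<longlongrightarrow> 0 * (norm (y - q))\<^sup>2 / 2) (at_right 0)"
    by (intro tendsto_intros) simp
  moreover have "eventually (\<lambda>t. ?A \<le> t * (norm (y - q))\<^sup>2 / 2) (at_right (0::real))"
    by (rule eventually_at_rightI[of 0 1]) (use * in auto)
  ultimately have "?A \<le> 0 * (norm (y - q))\<^sup>2 / 2"
    by (rule tendsto_lowerbound) simp
  then show ?thesis by (simp add: q_def)
qed

end

text \<open>Adding the variational inequalities at the two prox points cancels the values of \<phi>.
  The resulting continuity makes the iterates measurable.\<close>

lemma prox_nonexpansive:
  assumes "0 < \<gamma>"
  shows "norm (prox \<gamma> \<phi> z - prox \<gamma> \<phi> w) \<le> norm (z - w)"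
proof -
  define a b where "a = prox \<gamma> \<phi> z" and "b = prox \<gamma> \<phi> w"
  have "(z - a) \<bullet> (b - a) \<le> \<gamma> * (\<phi>r b - \<phi>r a)" "(w - b) \<bullet> (a - b) \<le> \<gamma> * (\<phi>r a - \<phi>r b)"
    unfolding a_def b_def using prox_variational prox_in assms by blast+
  then have "(z - a) \<bullet> (b - a) + (w - b) \<bullet> (a - b) \<le> 0" by (simp add: algebra_simps)
  then have "(a - b) \<bullet> (a - b) \<le> (z - w) \<bullet> (a - b)"
    by (simp add: algebra_simps inner_commute)
  also have "\<dots> \<le> norm (z - w) * norm (a - b)" by (rule norm_cauchy_schwarz)
  finally have "norm (a - b) * norm (a - b) \<le> norm (z - w) * norm (a - b)"
    by (simp add: power2_norm_eq_inner[symmetric] power2_eq_square)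
  then have "norm (a - b) \<le> norm (z - w)"
    by (cases "norm (a - b) = 0") (auto simp: mult_le_cancel_right)
  then show ?thesis by (simp add: a_def b_def)
qed

lemma continuous_prox: "0 < \<gamma> \<Longrightarrow> continuous_on UNIV (prox \<gamma> \<phi>)"
  using prox_nonexpansive[of \<gamma>]
  by (intro lipschitz_on_continuous_on[of 1] lipschitz_onI) (auto simp: dist_norm)

end

section \<open>The generalized Moreau envelope\<close>

lemma frechet_subdiffI_quadratic:
  fixes x v :: "'a::{real_inner, perfect_space}"
  assumes "0 < e" "\<And>y. dist x y < e \<Longrightarrow> m x + v \<bullet> (y - x) - k * (norm (y - x))\<^sup>2 \<le> m y"
  shows "v \<in> frechet_subdiff (\<lambda>y. ereal (m y)) x"
proof -
  have "((\<lambda>y. - k * norm (y - x)) \<longlongrightarrow> - k * norm (x - x)) (at x)"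
    by (intro tendsto_intros)
  then have l: "((\<lambda>y. ereal (- k * norm (y - x))) \<longlongrightarrow> ereal 0) (at x)"
    by (intro tendsto_ereal) simp
  have "eventually (\<lambda>y. ereal (- k * norm (y - x))
      \<le> (ereal (m y) - ereal (m x) - ereal (v \<bullet> (y - x))) / ereal (norm (y - x))) (at x)"
    unfolding eventually_at
  proof (intro exI[of _ e] conjI ballI impI, fact, elim conjE)
    fix y assume y: "y \<noteq> x" "dist y x < e"
    then have n: "0 < norm (y - x)" by simp
    have "- k * norm (y - x) * norm (y - x) \<le> m y - m x - v \<bullet> (y - x)"
      using assms(2)[of y] y(2) by (simp add: dist_commute power2_eq_square algebra_simps)
    then have "- k * norm (y - x) \<le> (m y - m x - v \<bullet> (y - x)) / norm (y - x)"
      using n by (simp add: pos_le_divide_eq)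
    then show "ereal (- k * norm (y - x))
      \<le> (ereal (m y) - ereal (m x) - ereal (v \<bullet> (y - x))) / ereal (norm (y - x))"
      using n by simp
  qed
  then have "Liminf (at x) (\<lambda>y. ereal (- k * norm (y - x)))
      \<le> Liminf (at x) (\<lambda>y. (ereal (m y) - ereal (m x) - ereal (v \<bullet> (y - x))) / ereal (norm (y - x)))"
    by (rule Liminf_mono)
  moreover have "Liminf (at x) (\<lambda>y. ereal (- k * norm (y - x))) = ereal 0"
    by (rule lim_imp_Liminf[OF _ l]) simp
  ultimately show ?thesis by (simp add: frechet_subdiff_def edom_def zero_ereal_def)
qed

text \<open>Testing with h = t d and dividing by t leaves |d|^2 bounded by terms that vanish as t
  tends to 0, because p > 1. It serves to equate the slopes of a lower and an upper model at the
  same point.\<close>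

lemma eq_zero_if_superlinear:
  fixes d :: "'a::real_inner"
  assumes p: "1 < p" and e: "0 < e"
    and le: "\<And>h. norm h < e \<Longrightarrow> d \<bullet> h \<le> k * (norm h)\<^sup>2 + c * norm h powr p"
  shows "d = 0"
proof (rule ccontr)
  assume d: "d \<noteq> 0"
  define n where "n = norm d"
  have n: "0 < n" using d by (simp add: n_def)
  have "n\<^sup>2 \<le> k * t * n\<^sup>2 + c * t powr (p - 1) * n powr p" if t: "0 < t" "t < e / n" for t
  proof -
    have "norm (t *\<^sub>R d) < e" using t n by (simp add: n_def[symmetric] field_simps)
    from le[OF this] have "t * n\<^sup>2 \<le> k * (t * n)\<^sup>2 + c * (t * n) powr p"
      using t by (simp add: n_def power2_norm_eq_inner)
    also have "\<dots> = t * (k * t * n\<^sup>2 + c * t powr (p - 1) * n powr p)"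
      using t n by (simp add: powr_mult powr_diff power2_eq_square algebra_simps)
    finally show ?thesis using t by simp
  qed
  then have ev: "eventually (\<lambda>t. n\<^sup>2 \<le> k * t * n\<^sup>2 + c * t powr (p - 1) * n powr p) (at_right 0)"
    using e n by (intro eventually_at_rightI[of 0 "e / n"]) auto
  have "((\<lambda>t. k * t * n\<^sup>2 + c * t powr (p - 1) * n powr p)
      \<longlongrightarrow> k * 0 * n\<^sup>2 + c * 0 powr (p - 1) * n powr p) (at_right 0)"
    using p by (intro tendsto_intros tendsto_powr2) (auto simp: eventually_at_filter)
  from tendsto_lowerbound[OF this ev] show False using n by simp
qed

lemma le_one_plus_powr:
  fixes t p :: real assumes "0 \<le> t" "1 \<le> p" shows "t \<le> 1 + t powr p"
proof (cases "t \<le> 1")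
  case False
  then have "t powr 1 \<le> t powr p" using assms by (intro powr_mono) auto
  then show ?thesis using False by simp
qed (simp add: add_increasing2)

locale moreau_envelope =
  fixes F :: "'a::euclidean_space \<Rightarrow> ereal" and p r Fmin :: real
  assumes p: "1 < p" "p < 2" and r: "0 < r"
    and F_real: "\<And>x. x \<in> edom F \<Longrightarrow> F x = ereal (real_of_ereal (F x))"
    and F_nonempty: "edom F \<noteq> {}"
    and F_closed: "closed (epi (edom F) (\<lambda>x. real_of_ereal (F x)))"
    and F_ge: "\<And>x. x \<in> edom F \<Longrightarrow> Fmin \<le> real_of_ereal (F x)"
begin

definition Q :: "'a \<Rightarrow> 'a \<Rightarrow> real" where
  "Q x y = real_of_ereal (F y) + norm (x - y) powr p / (r * p)"

definition minimizer :: "'a \<Rightarrow> 'a \<Rightarrow> bool" where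
  "minimizer x y \<longleftrightarrow> y \<in> edom F \<and> (\<forall>y'\<in>edom F. Q x y \<le> Q x y')"

definition m :: "'a \<Rightarrow> real" where "m x = real_of_ereal (moreau_env p r F x)"

text \<open>The gradient of |w|^p / (r p). At \<open>w = 0\<close> the formula yields the correct
  value 0.\<close>

definition grad :: "'a \<Rightarrow> 'a" where "grad w = (norm w powr (p - 2) / r) *\<^sub>R w"

lemma F_add: "x \<in> edom F \<Longrightarrow> F x + ereal c = ereal (real_of_ereal (F x) + c)"
  using F_real[of x] by (cases "F x") auto

text \<open>Coercivity in an explicit form: t <= 1 + t^p replaces a p-th root. It gives existence of
  minimizers, local boundedness of their distances, and compactness in the limit argument.\<close>

lemma norm_le_of_Q_le:
  assumes "y \<in> edom F" "Q x y \<le> c"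
  shows "norm (x - y) \<le> 1 + r * p * (c - Fmin)"
proof -
  have "norm (x - y) powr p / (r * p) \<le> c - Fmin"
    using assms F_ge[of y] by (simp add: Q_def)
  then have "norm (x - y) powr p \<le> r * p * (c - Fmin)" using p r by (simp add: field_simps)
  then show ?thesis using le_one_plus_powr[of "norm (x - y)" p] p by simp
qed

lemma minimizer_exists: "\<exists>y. minimizer x y"
proof -
  obtain w where w: "w \<in> edom F" using F_nonempty by blast
  have cl: "closed (epi (edom F) (\<lambda>y. Q x y))"
    unfolding Q_def using p r
    by (intro closed_epi_add_continuous[OF F_closed] continuous_intros continuous_on_powr') auto
  have "bounded {y \<in> edom F. Q x y \<le> Q x w}"
    unfolding bounded_iff
  proof (intro exI ballI)
    fix y assume "y \<in> {y \<in> edom F. Q x y \<le> Q x w}"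
    then have "norm (x - y) \<le> 1 + r * p * (Q x w - Fmin)" by (intro norm_le_of_Q_le) auto
    then show "norm y \<le> norm x + (1 + r * p * (Q x w - Fmin))"
      using norm_triangle_ineq4[of x "x - y"] by simp
  qed
  with cl w show ?thesis
    by (rule closed_epi_attains_min) (auto simp: minimizer_def)
qed

lemma moreau_env_eq:
  assumes "minimizer x y" shows "moreau_env p r F x = ereal (Q x y)"
  unfolding moreau_env_def
proof (rule antisym)
  have "F y + ereal (norm (x - y) powr p / (r * p)) = ereal (Q x y)"
    unfolding Q_def by (rule F_add) (use assms in \<open>simp add: minimizer_def\<close>)
  then show "(INF y. F y + ereal (norm (x - y) powr p / (r * p))) \<le> ereal (Q x y)"
    using INF_lower[of y UNIV "\<lambda>y. F y + ereal (norm (x - y) powr p / (r * p))"] by simp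
next
  show "ereal (Q x y) \<le> (INF y. F y + ereal (norm (x - y) powr p / (r * p)))"
  proof (rule INF_greatest)
    fix z
    show "ereal (Q x y) \<le> F z + ereal (norm (x - z) powr p / (r * p))"
    proof (cases "z \<in> edom F")
      case True
      then have "F z + ereal (norm (x - z) powr p / (r * p)) = ereal (Q x z)"
        unfolding Q_def by (rule F_add)
      then show ?thesis using assms True by (simp add: minimizer_def)
    qed (simp add: edom_def)
  qed
qed

lemma m_eq: "minimizer x y \<Longrightarrow> m x = Q x y"
  by (simp add: m_def moreau_env_eq)

lemma moreau_env_eq_m: "moreau_env p r F x = ereal (m x)"
  using minimizer_exists[of x] moreau_env_eq m_eq by metis

lemma m_le: "y \<in> edom F \<Longrightarrow> m x \<le> Q x y"
  using minimizer_exists[of x] m_eq unfolding minimizer_def by metis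

lemma minimizerI: "y \<in> edom F \<Longrightarrow> Q x y \<le> m x \<Longrightarrow> minimizer x y"
  unfolding minimizer_def using m_le order_trans by blast

lemma Fmin_le_m: "Fmin \<le> m x"
proof -
  obtain y where y: "minimizer x y" using minimizer_exists by blast
  then have "Fmin \<le> real_of_ereal (F y)" using F_ge by (simp add: minimizer_def)
  moreover have "0 \<le> norm (x - y) powr p / (r * p)" using p r by simp
  ultimately show ?thesis using m_eq[OF y] by (simp add: Q_def)
qed

lemma norm_minimizer_le:
  assumes "minimizer x y" shows "norm (x - y) \<le> 1 + r * p * (m x - Fmin)"
  using assms m_eq[OF assms] by (intro norm_le_of_Q_le) (auto simp: minimizer_def)

lemma norm_grad: "norm (grad w) = norm w powr (p - 1) / r"
  using r by (cases "w = 0") (auto simp: grad_def powr_diff power2_eq_square field_simps)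

text \<open>The minimizer for \<open>x\<close> is kept as a competitor for \<open>x + h\<close>, and
  the p-th power is expanded around \<open>x - y\<close>. Every minimizer thus gives an upper model
  with its own slope.\<close>

lemma m_upper_model:
  assumes y: "minimizer x y"
  shows "m (x + h) \<le> m x + grad (x - y) \<bullet> h + (1 + p) / (r * p) * norm h powr p"
proof -
  have rp: "0 < r * p" using p r by simp
  have "m (x + h) \<le> Q (x + h) y" using y by (intro m_le) (simp add: minimizer_def)
  moreover have "norm (x + h - y) powr p / (r * p) \<le> (norm (x - y) powr p
      + p * norm (x - y) powr (p - 2) * ((x - y) \<bullet> h) + (1 + p) * norm h powr p) / (r * p)"
    using norm_add_powr_le[OF p, of "x - y" h] rp
    by (intro divide_right_mono) (auto simp: algebra_simps)
  moreover have "\<dots> = norm (x - y) powr p / (r * p) + grad (x - y) \<bullet> h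
      + (1 + p) / (r * p) * norm h powr p"
  proof -
    have "grad (x - y) \<bullet> h = norm (x - y) powr (p - 2) * ((x - y) \<bullet> h) / r"
      by (simp add: grad_def)
    then show ?thesis using p r by (simp add: field_simps del: inner_diff_left)
  qed
  ultimately show ?thesis unfolding m_eq[OF y] Q_def by linarith
qed

text \<open>The upper estimate is the model at \<open>x\<close>. The lower one is the model at the
  nearby point \<open>x'\<close> with displacement \<open>x - x'\<close>; the upper estimate bounds
  \<open>m x'\<close>, hence the distance of \<open>x'\<close> to its minimizer, and so
  \<open>B\<close> bounds all slopes within distance 1.\<close>

lemma continuous_m: "continuous_on UNIV m"
proof -
  have "(m \<longlongrightarrow> m x) (at x)" for x
  proof -
    obtain y where y: "minimizer x y" using minimizer_exists by blast
    define c where "c = (1 + p) / (r * p)"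
    have c: "0 < c" using p r by (simp add: c_def)
    have up: "m x' \<le> m x + norm (grad (x - y)) * norm (x' - x) + c * norm (x' - x) powr p" for x'
      using m_upper_model[OF y, of "x' - x"] norm_cauchy_schwarz[of "grad (x - y)" "x' - x"]
      by (simp add: c_def)
    define B where "B = (1 + r * p * (m x + norm (grad (x - y)) + c - Fmin)) powr (p - 1) / r"
    have lo: "m x - B * norm (x' - x) - c * norm (x' - x) powr p \<le> m x'"
      if d: "norm (x' - x) < 1" for x'
    proof -
      obtain y' where y': "minimizer x' y'" using minimizer_exists by blast
      have "norm (x' - x) powr p \<le> 1" using d p by (intro powr_le1) auto
      then have "c * norm (x' - x) powr p \<le> c" using c by simp
      moreover have "norm (grad (x - y)) * norm (x' - x) \<le> norm (grad (x - y))"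
        using d by (intro mult_left_le) auto
      ultimately have "m x' \<le> m x + norm (grad (x - y)) + c" using up[of x'] by linarith
      then have "r * p * (m x' - Fmin) \<le> r * p * (m x + norm (grad (x - y)) + c - Fmin)"
        using p r by (intro mult_left_mono) auto
      then have "norm (x' - y') \<le> 1 + r * p * (m x + norm (grad (x - y)) + c - Fmin)"
        using norm_minimizer_le[OF y'] by linarith
      then have "norm (grad (x' - y')) \<le> B"
        unfolding norm_grad B_def using p r by (intro divide_right_mono powr_mono2) auto
      then have "norm (grad (x' - y')) * norm (x - x') \<le> B * norm (x - x')"
        by (intro mult_right_mono) auto
      then show ?thesis
        using m_upper_model[OF y', of "x - x'"] norm_cauchy_schwarz[of "grad (x' - y')" "x - x'"]
        by (simp add: c_def norm_minus_commute)
    qed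
    have nt: "((\<lambda>x'. norm (x' - x)) \<longlongrightarrow> 0) (at x)"
      by (intro tendsto_norm_zero LIM_zero) simp
    have np: "((\<lambda>x'. norm (x' - x) powr p) \<longlongrightarrow> 0) (at x)"
      using p by (intro tendsto_zero_powrI[OF nt tendsto_const]) auto
    show ?thesis
    proof (rule tendsto_sandwich)
      show "((\<lambda>x'. m x - B * norm (x' - x) - c * norm (x' - x) powr p) \<longlongrightarrow> m x) (at x)"
        using tendsto_diff[OF tendsto_diff[OF tendsto_const tendsto_mult[OF tendsto_const nt]]
            tendsto_mult[OF tendsto_const np], of "m x" B c] by simp
      show "((\<lambda>x'. m x + norm (grad (x - y)) * norm (x' - x) + c * norm (x' - x) powr p)
          \<longlongrightarrow> m x) (at x)"
        using tendsto_add[OF tendsto_add[OF tendsto_const tendsto_mult[OF tendsto_const nt]]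
            tendsto_mult[OF tendsto_const np], of "m x" "norm (grad (x - y))" c] by simp
      show "eventually (\<lambda>x'. m x - B * norm (x' - x) - c * norm (x' - x) powr p \<le> m x') (at x)"
        unfolding eventually_at using lo by (intro exI[of _ 1]) (auto simp: dist_norm)
    qed (use up in auto)
  qed
  then show ?thesis by (simp add: continuous_on_def)
qed

text \<open>At the origin the factor |w|^(p-2) is singular, but the norm of \<open>grad\<close> is
  |w|^(p-1) / r, which still tends to 0.\<close>

lemma tendsto_grad:
  assumes "X \<longlonglongrightarrow> w" shows "(\<lambda>k. grad (X k)) \<longlonglongrightarrow> grad w"
proof (cases "w = 0")
  case True
  have "(\<lambda>k. norm (X k)) \<longlonglongrightarrow> 0" using assms True by (simp add: tendsto_norm_zero)
  then have "(\<lambda>k. norm (X k) powr (p - 1)) \<longlonglongrightarrow> 0"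
    using p by (intro tendsto_zero_powrI[OF _ tendsto_const]) auto
  then have "(\<lambda>k. norm (grad (X k))) \<longlonglongrightarrow> 0"
    unfolding norm_grad using tendsto_divide_zero by blast
  then have "(\<lambda>k. grad (X k)) \<longlonglongrightarrow> 0" by (rule tendsto_norm_zero_cancel)
  then show ?thesis using True by (simp add: grad_def)
next
  case False
  then show ?thesis unfolding grad_def using assms r by (intro tendsto_intros) auto
qed

text \<open>Minimizing \<open>m + k * |\<cdot> - x|\<^sup>2\<close> gives a point near \<open>x\<close> where \<open>m\<close> has a quadratic
  minorant; comparing it with \<open>m_upper_model\<close> identifies its slope with \<open>grad\<close>.\<close>

lemma frechet_subgradient_near:
  assumes k: "m x - Fmin < k"
  obtains y z where "minimizer y z" "grad (y - z) \<in> frechet_subdiff (moreau_env p r F) y"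
    "k * (norm (y - x))\<^sup>2 \<le> m x - Fmin" "m y \<le> m x"
proof -
  have k0: "0 < k" using k Fmin_le_m[of x] by simp
  have "continuous_on (cball x 1) (\<lambda>y. m y + k * (norm (y - x))\<^sup>2)"
    by (intro continuous_intros continuous_on_subset[OF continuous_m]) auto
  then obtain y where y: "y \<in> cball x 1"
    "\<And>u. u \<in> cball x 1 \<Longrightarrow> m y + k * (norm (y - x))\<^sup>2 \<le> m u + k * (norm (u - x))\<^sup>2"
    using continuous_attains_inf[of "cball x 1" "\<lambda>y. m y + k * (norm (y - x))\<^sup>2"] by auto
  have yx: "m y + k * (norm (y - x))\<^sup>2 \<le> m x" using y(2)[of x] by simp
  then have 1: "k * (norm (y - x))\<^sup>2 \<le> m x - Fmin" using Fmin_le_m[of y] by linarith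
  have "0 \<le> k * (norm (y - x))\<^sup>2" using k0 by simp
  then have 2: "m y \<le> m x" using yx by linarith
  \<comment> \<open>The penalty weight exceeds \<open>m x - Fmin\<close>, so the minimizer over the
    ball lies in its interior and minimality holds for all small displacements.\<close>
  have "norm (y - x) < 1"
  proof (rule ccontr)
    assume "\<not> norm (y - x) < 1"
    then have "k * 1 \<le> k * (norm (y - x))\<^sup>2" using k0 by (intro mult_left_mono one_le_power) auto
    then show False using 1 k by simp
  qed
  then obtain e where e: "0 < e" "ball y e \<subseteq> cball x 1"
    by (metis ball_subset_cball dist_commute dist_norm mem_ball open_ball open_contains_ball order_trans)
  obtain z where z: "minimizer y z" using minimizer_exists by blast
  \<comment> \<open>The negative gradient of the penalty at \<open>y\<close>: minimality of the
    penalized function makes it the slope of a quadratic minorant of \<open>m\<close>.\<close>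
  define v where "v = (- 2 * k) *\<^sub>R (y - x)"
  have lo: "m y + v \<bullet> h - k * (norm h)\<^sup>2 \<le> m (y + h)" if h: "norm h < e" for h
  proof -
    have "y + h \<in> ball y e" using h by (simp add: dist_norm)
    then have "m y + k * (norm (y - x))\<^sup>2 \<le> m (y + h) + k * (norm (y + h - x))\<^sup>2"
      using e(2) by (intro y(2)) auto
    moreover have "(norm (y + h - x))\<^sup>2 = (norm (y - x))\<^sup>2 + 2 * ((y - x) \<bullet> h) + (norm h)\<^sup>2"
      using norm_add_scaleR_power2[of "y - x" 1 h] by (simp add: add_diff_eq add.commute)
    ultimately have "m y + k * (norm (y - x))\<^sup>2
        \<le> m (y + h) + k * ((norm (y - x))\<^sup>2 + 2 * ((y - x) \<bullet> h) + (norm h)\<^sup>2)" by simp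
    then have "m y - 2 * k * ((y - x) \<bullet> h) - k * (norm h)\<^sup>2 \<le> m (y + h)"
      unfolding distrib_left by linarith
    then show ?thesis by (simp add: v_def)
  qed
  have "v - grad (y - z) = 0"
  proof (rule eq_zero_if_superlinear[OF p(1) e(1)])
    fix h :: 'a assume "norm h < e"
    from lo[OF this] m_upper_model[OF z, of h]
    show "(v - grad (y - z)) \<bullet> h \<le> k * (norm h)\<^sup>2 + (1 + p) / (r * p) * norm h powr p"
      by (simp add: inner_diff_left)
  qed
  then have v: "v = grad (y - z)" by simp
  have "v \<in> frechet_subdiff (\<lambda>y. ereal (m y)) y"
  proof (rule frechet_subdiffI_quadratic[OF e(1)])
    fix u assume "dist y u < e"
    then show "m y + v \<bullet> (u - y) - k * (norm (u - y))\<^sup>2 \<le> m u"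
      using lo[of "u - y"] by (simp add: dist_norm norm_minus_commute)
  qed
  then have "grad (y - z) \<in> frechet_subdiff (moreau_env p r F) y"
    unfolding v moreau_env_eq_m[abs_def] .
  with z 1 2 show ?thesis by (intro that)
qed

text \<open>Increasing penalties produce points \<open>Y k\<close> tending to \<open>x\<close> with
  Frechet subgradients given by minimizers \<open>Z k\<close>. These stay bounded, and a cluster
  point is the required minimizer for \<open>x\<close>; which one occurs cannot be
  prescribed.\<close>

lemma limiting_subgradient:
  obtains y where "minimizer x y" "grad (x - y) \<in> limiting_subdiff (moreau_env p r F) x"
proof -
  define c where "c = m x - Fmin"
  have c: "0 \<le> c" using Fmin_le_m[of x] by (simp add: c_def)
  have "\<forall>k. \<exists>y z. minimizer y z \<and> grad (y - z) \<in> frechet_subdiff (moreau_env p r F) y \<and>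
    (c + real (Suc k)) * (norm (y - x))\<^sup>2 \<le> c \<and> m y \<le> m x"
  proof
    fix k :: nat
    have "m x - Fmin < c + real (Suc k)" by (simp add: c_def)
    from frechet_subgradient_near[OF this]
    show "\<exists>y z. minimizer y z \<and> grad (y - z) \<in> frechet_subdiff (moreau_env p r F) y \<and>
    (c + real (Suc k)) * (norm (y - x))\<^sup>2 \<le> c \<and> m y \<le> m x"
      unfolding c_def by metis
  qed
  then obtain Y Z where YZ: "\<And>k. minimizer (Y k) (Z k)"
      "\<And>k. grad (Y k - Z k) \<in> frechet_subdiff (moreau_env p r F) (Y k)"
      "\<And>k. (c + real (Suc k)) * (norm (Y k - x))\<^sup>2 \<le> c" "\<And>k. m (Y k) \<le> m x"
    by metis
  have le: "(norm (Y k - x))\<^sup>2 \<le> c / (real (Suc k))" for k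
  proof -
    have "0 \<le> c * (norm (Y k - x))\<^sup>2" using c by simp
    then have "real (Suc k) * (norm (Y k - x))\<^sup>2 \<le> c"
      using YZ(3)[of k] unfolding distrib_right by linarith
    then show ?thesis by (simp add: field_simps)
  qed
  have "(\<lambda>k. c / real (Suc k)) \<longlonglongrightarrow> 0"
    by (rule LIMSEQ_Suc[OF lim_const_over_n[of c]])
  then have "(\<lambda>k. (norm (Y k - x))\<^sup>2) \<longlonglongrightarrow> 0"
    by (rule tendsto_sandwich[OF _ _ tendsto_const, rotated 2]) (auto intro!: always_eventually le simp del: of_nat_Suc)
  then have "(\<lambda>k. norm (Y k - x)) \<longlonglongrightarrow> 0"
    using tendsto_real_sqrt[of "\<lambda>k. (norm (Y k - x))\<^sup>2" 0] by simp
  then have Y: "Y \<longlonglongrightarrow> x" by (simp add: LIM_zero_iff tendsto_norm_zero_iff)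
  obtain B where B: "\<And>k. norm (Y k) \<le> B"
    using convergent_imp_Bseq[of Y] Y unfolding convergent_def Bseq_def by blast
  have "bounded (range Z)"
    unfolding bounded_iff
  proof (intro exI ballI)
    fix z assume "z \<in> range Z"
    then obtain k where k: "z = Z k" by blast
    have "norm (Y k - Z k) \<le> 1 + r * p * (m (Y k) - Fmin)" by (rule norm_minimizer_le[OF YZ(1)])
    also have "\<dots> \<le> 1 + r * p * c"
      using YZ(4)[of k] p r by (simp add: c_def)
    finally have 1: "norm (Y k - Z k) \<le> 1 + r * p * c" .
    show "norm z \<le> B + (1 + r * p * c)"
      using B[of k] 1 norm_triangle_ineq4[of "Y k" "Y k - Z k"] k by simp
  qed
  then obtain z \<sigma> where \<sigma>: "strict_mono \<sigma>" "(Z \<circ> \<sigma>) \<longlonglongrightarrow> z"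
    using bounded_imp_convergent_subsequence by blast
  have Y\<sigma>: "(Y \<circ> \<sigma>) \<longlonglongrightarrow> x" using Y \<sigma>(1) by (rule LIMSEQ_subseq_LIMSEQ)
  have m\<sigma>: "(\<lambda>k. m ((Y \<circ> \<sigma>) k)) \<longlonglongrightarrow> m x"
    using continuous_on_tendsto_compose[OF continuous_m Y\<sigma>] by simp
  have YZ\<sigma>: "(\<lambda>k. Y (\<sigma> k) - Z (\<sigma> k)) \<longlonglongrightarrow> x - z"
    using tendsto_diff[OF Y\<sigma> \<sigma>(2)] by simp
  have pw: "(\<lambda>k. norm (Y (\<sigma> k) - Z (\<sigma> k)) powr p) \<longlonglongrightarrow> norm (x - z) powr p"
    using p by (intro tendsto_powr2 tendsto_norm YZ\<sigma> tendsto_const) auto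
  \<comment> \<open>The value of F at \<open>Z k\<close> is \<open>m (Y k)\<close> minus the kernel
    term, and both converge; the closed epigraph then gives \<open>Q x z \<le> m x\<close>.\<close>
  have "z \<in> edom F \<and> real_of_ereal (F z) \<le> m x - norm (x - z) powr p / (r * p)"
  proof (rule closed_epi_limit[OF F_closed _ \<sigma>(2)])
    show "(\<lambda>k. m ((Y \<circ> \<sigma>) k) - norm (Y (\<sigma> k) - Z (\<sigma> k)) powr p / (r * p))
        \<longlonglongrightarrow> m x - norm (x - z) powr p / (r * p)"
      using p r by (intro tendsto_diff m\<sigma> tendsto_divide pw tendsto_const) auto
    show "real_of_ereal (F ((Z \<circ> \<sigma>) k))
        \<le> m ((Y \<circ> \<sigma>) k) - norm (Y (\<sigma> k) - Z (\<sigma> k)) powr p / (r * p)" for k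
      using m_eq[OF YZ(1)[of "\<sigma> k"]] by (simp add: Q_def)
    show "(Z \<circ> \<sigma>) k \<in> edom F" for k using YZ(1) by (simp add: minimizer_def)
  qed
  then have z: "minimizer x z" by (intro minimizerI) (auto simp: Q_def)
  have "grad (x - z) \<in> limiting_subdiff (moreau_env p r F) x"
    unfolding limiting_subdiff_def mem_Collect_eq
  proof (intro exI conjI allI)
    show "(Y \<circ> \<sigma>) \<longlonglongrightarrow> x" by fact
    show "(\<lambda>k. moreau_env p r F ((Y \<circ> \<sigma>) k)) \<longlonglongrightarrow> moreau_env p r F x"
      unfolding moreau_env_eq_m using m\<sigma> by (intro tendsto_ereal)
    show "(\<lambda>k. grad (Y (\<sigma> k) - Z (\<sigma> k))) k \<in> frechet_subdiff (moreau_env p r F) ((Y \<circ> \<sigma>) k)" for k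
      using YZ(2) by simp
    show "(\<lambda>k. grad (Y (\<sigma> k) - Z (\<sigma> k))) \<longlonglongrightarrow> grad (x - z)"
      by (rule tendsto_grad[OF YZ\<sigma>])
  qed
  with z show ?thesis by (rule that)
qed

lemma dist_zero_limiting_subdiff_le:
  obtains y where "minimizer x y"
    "dist_zero (limiting_subdiff (moreau_env p r F) x) \<le> ennreal (norm (x - y) powr (p - 1) / r)"
proof -
  obtain y where y: "minimizer x y" "grad (x - y) \<in> limiting_subdiff (moreau_env p r F) x"
    using limiting_subgradient by blast
  have "dist_zero (limiting_subdiff (moreau_env p r F) x) \<le> ennreal (norm (grad (x - y)))"
    unfolding dist_zero_def by (rule INF_lower[OF y(2)])
  with y(1) show ?thesis by (intro that) (simp_all only: norm_grad)
qed

end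

section \<open>Subgradients of paraconvex functions\<close>

text \<open>Paraconvexity makes the local inequality global. The Frechet condition is used at a
  point q close to \<open>x\<close> on the segment to \<open>y\<close>, with slope error
  \<open>e\<close>; the upper bound of f at q by its values at the end points is inserted, the
  result is divided by t, and \<open>e\<close> tends to 0.\<close>

lemma frechet_subgradient_paraconvex_ineq:
  assumes f: "paraconvex \<rho> p f" and v: "v \<in> frechet_subdiff f x"
    and fx: "f x = ereal a" and fy: "f y = ereal b" and \<rho>: "0 < \<rho>" "0 < p"
  shows "a + v \<bullet> (y - x) - \<rho> / p * norm (y - x) powr p \<le> b"
proof (cases "y = x")
  case False
  define d where "d = y - x"
  have d: "0 < norm d" using False by (simp add: d_def)
  have "v \<bullet> d - \<rho> / p * norm d powr p + a - b \<le> e * norm d" if e: "0 < e" for e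
  proof -
    have "ereal (- e) < 0" using e by simp
    also have "0 \<le> Liminf (at x) (\<lambda>y. (f y - f x - ereal (v \<bullet> (y - x))) / ereal (norm (y - x)))"
      using v by (simp add: frechet_subdiff_def)
    finally have "eventually (\<lambda>y. ereal (- e) < (f y - f x - ereal (v \<bullet> (y - x))) / ereal (norm (y - x))) (at x)"
      by (rule less_LiminfD)
    then obtain \<delta> where \<delta>: "0 < \<delta>" "\<And>y. y \<noteq> x \<Longrightarrow> dist y x < \<delta> \<Longrightarrow>
        ereal (- e) < (f y - f x - ereal (v \<bullet> (y - x))) / ereal (norm (y - x))"
      unfolding eventually_at by auto
    define t where "t = min (1 / 2) (\<delta> / (2 * norm d))"
    have t: "0 < t" "t \<le> 1" using \<delta>(1) d by (auto simp: t_def)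
    have "t * norm d \<le> \<delta> / (2 * norm d) * norm d" by (intro mult_right_mono) (auto simp: t_def)
    then have t\<delta>: "t * norm d < \<delta>" using d \<delta>(1) by simp
    define q where "q = t *\<^sub>R y + (1 - t) *\<^sub>R x"
    have q: "q - x = t *\<^sub>R d" by (simp add: q_def d_def algebra_simps)
    have "f q \<le> ereal t * f y + ereal (1 - t) * f x + ereal (\<rho> / p * t * (1 - t) * norm (y - x) powr p)"
      using f t unfolding paraconvex_def q_def by auto
    also have "\<dots> = ereal (t * b + (1 - t) * a + \<rho> / p * t * (1 - t) * norm d powr p)"
      by (simp add: fx fy d_def)
    finally have fq: "f q \<le> ereal (t * b + (1 - t) * a + \<rho> / p * t * (1 - t) * norm d powr p)" .
    moreover have "f q \<noteq> -\<infinity>" using f by (simp add: paraconvex_def proper_def)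
    ultimately obtain c where c: "f q = ereal c" by (cases "f q") auto
    have nq: "norm (q - x) = t * norm d" using t by (simp add: q)
    have "q \<noteq> x" using nq d t by auto
    moreover have "dist q x < \<delta>" using nq t\<delta> by (simp add: dist_norm)
    ultimately have "ereal (- e) < (f q - f x - ereal (v \<bullet> (q - x))) / ereal (norm (q - x))"
      by (rule \<delta>(2))
    then have "- e < (c - a - t * (v \<bullet> d)) / (t * norm d)"
      using t d by (simp add: c fx nq q)
    then have "- e * (t * norm d) < c - a - t * (v \<bullet> d)"
      using t d by (simp add: pos_less_divide_eq)
    moreover have "\<rho> / p * t * (1 - t) * norm d powr p \<le> \<rho> / p * t * 1 * norm d powr p"
      using t \<rho> by (intro mult_right_mono mult_left_mono) auto
    moreover have "c \<le> t * b + (1 - t) * a + \<rho> / p * t * (1 - t) * norm d powr p"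
      using fq by (simp add: c)
    ultimately have "- e * (t * norm d) \<le> t * b + (1 - t) * a + \<rho> / p * t * 1 * norm d powr p - a - t * (v \<bullet> d)"
      by linarith
    then have "t * (v \<bullet> d - \<rho> / p * norm d powr p + a - b) \<le> t * (e * norm d)"
      by (simp add: algebra_simps)
    then show ?thesis using t by simp
  qed
  from this[of "e / norm d" for e] d
  have "v \<bullet> d - \<rho> / p * norm d powr p + a - b \<le> 0 + e" if "0 < e" for e
    using that by simp
  then have "v \<bullet> d - \<rho> / p * norm d powr p + a - b \<le> 0" by (rule field_le_epsilon)
  then show ?thesis by (simp add: d_def)
qed (use fx fy in simp)

lemma limiting_subgradient_paraconvex_ineq:
  assumes f: "paraconvex \<rho> p f" and v: "v \<in> limiting_subdiff f x"
    and fx: "f x = ereal a" and fy: "f y = ereal b" and \<rho>: "0 < \<rho>" "0 < p"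
  shows "a + v \<bullet> (y - x) - \<rho> / p * norm (y - x) powr p \<le> b"
proof -
  obtain xs vs where s: "xs \<longlonglongrightarrow> x" "(\<lambda>k. f (xs k)) \<longlonglongrightarrow> f x"
      "\<And>k. vs k \<in> frechet_subdiff f (xs k)" "vs \<longlonglongrightarrow> v"
    using v unfolding limiting_subdiff_def by blast
  let ?R = "\<lambda>k. b - vs k \<bullet> (y - xs k) + \<rho> / p * norm (y - xs k) powr p"
  have le: "f (xs k) \<le> ereal (?R k)" for k
  proof -
    have "f (xs k) < \<infinity>" using s(3)[of k] by (auto simp: frechet_subdiff_def edom_def)
    moreover have "f (xs k) \<noteq> -\<infinity>" using f by (simp add: paraconvex_def proper_def)
    ultimately obtain c where c: "f (xs k) = ereal c" by (cases "f (xs k)") auto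
    from frechet_subgradient_paraconvex_ineq[OF f s(3) c fy \<rho>] show ?thesis by (simp add: c)
  qed
  have "?R \<longlonglongrightarrow> b - v \<bullet> (y - x) + \<rho> / p * norm (y - x) powr p"
    using s \<rho>(2) by (intro tendsto_intros tendsto_powr2) auto
  then have lim: "(\<lambda>k. ereal (?R k)) \<longlonglongrightarrow> ereal (b - v \<bullet> (y - x) + \<rho> / p * norm (y - x) powr p)"
    by (rule tendsto_ereal)
  have "f x \<le> ereal (b - v \<bullet> (y - x) + \<rho> / p * norm (y - x) powr p)"
    using LIMSEQ_le[OF s(2) lim] le by blast
  then show ?thesis by (simp add: fx)
qed

text \<open>The oracle enters here only through a deterministic consequence: a limiting subgradient
  of norm at most \<open>L\<close> at every point of the domain of \<phi>. It is needed along whole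
  segments, not merely at iterates.\<close>

locale paraconvex_composite = proper_lsc_convex \<phi> + moreau_envelope "\<lambda>y. f y + \<phi> y" p r Fmin
  for \<phi> f :: "'a::euclidean_space \<Rightarrow> ereal" and p r Fmin :: real +
  fixes \<rho> L :: real
  assumes \<rho>: "0 < \<rho>" and r\<rho>: "r < 1 / (2 * \<rho>)" and L: "0 < L"
    and f_lsc: "lower_semicontinuous f" and f_para: "paraconvex \<rho> p f"
    and f_finite: "\<And>x. x \<in> edom \<phi> \<Longrightarrow> \<bar>f x\<bar> \<noteq> \<infinity>"
    and subgrad_bounded: "\<And>x. x \<in> edom \<phi> \<Longrightarrow> \<exists>v \<in> limiting_subdiff f x. norm v \<le> L"
begin

definition fr :: "'a \<Rightarrow> real" where "fr x = real_of_ereal (f x)"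

lemma f_eq: "x \<in> edom \<phi> \<Longrightarrow> f x = ereal (fr x)"
  using f_finite[of x] by (simp add: fr_def ereal_real)

lemma f_not_MInf: "f x \<noteq> -\<infinity>"
  using f_para by (simp add: paraconvex_def proper_def)

lemma edom_F: "edom (\<lambda>y. f y + \<phi> y) = edom \<phi>"
proof (intro equalityI subsetI)
  fix x assume "x \<in> edom (\<lambda>y. f y + \<phi> y)"
  then show "x \<in> edom \<phi>" by (auto simp: edom_def)
next
  fix x assume "x \<in> edom \<phi>"
  then show "x \<in> edom (\<lambda>y. f y + \<phi> y)" using f_eq[of x] \<phi>_eq[of x] by (auto simp: edom_def)
qed

lemma real_F: "x \<in> edom \<phi> \<Longrightarrow> real_of_ereal (f x + \<phi> x) = fr x + \<phi>r x"
  by (simp add: f_eq \<phi>_eq)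

lemma minimizer_in: "minimizer x y \<Longrightarrow> y \<in> edom \<phi>"
  by (simp add: minimizer_def edom_F)

lemma subgradient_ineq:
  assumes "v \<in> limiting_subdiff f x" "x \<in> edom \<phi>" "y \<in> edom \<phi>"
  shows "fr x + v \<bullet> (y - x) - \<rho> / p * norm (y - x) powr p \<le> fr y"
  using limiting_subgradient_paraconvex_ineq[OF f_para assms(1) f_eq[OF assms(2)] f_eq[OF assms(3)] \<rho>] p
  by simp

text \<open>First-order optimality along the segment from the minimizer \<open>y\<close> to \<open>z\<close>; the subgradient \<open>v\<close>
  of \<open>f\<close> at \<open>y\<close> is a cluster point of bounded subgradients on the segment and depends on \<open>z\<close>.\<close>

lemma minimizer_optimality:
  assumes y: "minimizer x y" and z: "z \<in> edom \<phi>" and x: "x \<in> edom \<phi>"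
  obtains v where "norm v \<le> L" "(grad (x - y) - v) \<bullet> (z - y) \<le> \<phi>r z - \<phi>r y"
    "v \<bullet> (x - y) \<le> fr x - fr y + \<rho> / p * norm (x - y) powr p"
proof -
  have rp: "0 < r * p" using p r by simp
  define e where "e = z - y"
  define T where "T k = inverse (real (Suc k))" for k
  have T: "0 < T k" "T k \<le> 1" for k by (auto simp: T_def inverse_le_1_iff)
  have T0: "T \<longlonglongrightarrow> 0" unfolding T_def by (rule LIMSEQ_inverse_real_of_nat)
  define S where "S k = T k *\<^sub>R z + (1 - T k) *\<^sub>R y" for k
  have Se: "S k = y + T k *\<^sub>R e" for k by (simp add: S_def e_def algebra_simps)
  have y_in: "y \<in> edom \<phi>" by (rule minimizer_in[OF y])
  have S: "S k \<in> edom \<phi>" "\<phi>r (S k) \<le> T k * \<phi>r z + (1 - T k) * \<phi>r y" for k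
    using convexD[OF z y_in, of "T k"] T[of k] by (auto simp: S_def)
  have S0: "S \<longlonglongrightarrow> y"
    unfolding Se[abs_def] using tendsto_add[OF tendsto_const tendsto_scaleR[OF T0 tendsto_const], of y e]
    by simp
  obtain V where V: "\<And>k. V k \<in> limiting_subdiff f (S k)" "\<And>k. norm (V k) \<le> L"
    using subgrad_bounded[OF S(1)] by metis
  have "bounded (range V)" using V(2) by (auto simp: bounded_iff)
  then obtain v \<sigma> where \<sigma>: "strict_mono \<sigma>" "(V \<circ> \<sigma>) \<longlonglongrightarrow> v"
    using bounded_imp_convergent_subsequence by blast
  have T\<sigma>: "(\<lambda>k. T (\<sigma> k)) \<longlonglongrightarrow> 0" using LIMSEQ_subseq_LIMSEQ[OF T0 \<sigma>(1)] by (simp add: o_def)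
  have S\<sigma>: "(\<lambda>k. S (\<sigma> k)) \<longlonglongrightarrow> y" using LIMSEQ_subseq_LIMSEQ[OF S0 \<sigma>(1)] by (simp add: o_def)
  have V\<sigma>: "(\<lambda>k. V (\<sigma> k)) \<longlonglongrightarrow> v" using \<sigma>(2) by (simp add: o_def)
  \<comment> \<open>Collects the errors of order \<open>T k powr p\<close> from paraconvexity and
    from the expansion of the kernel; after division by \<open>T k\<close> they still vanish since p
    > 1.\<close>
  define C where "C = (\<rho> / p + (1 + p) / (r * p)) * norm e powr p"
  \<comment> \<open>Optimality of \<open>y\<close> against \<open>S k\<close> requires an upper
    bound for f at \<open>S k\<close>. A subgradient at \<open>y\<close> would bound it from below,
    so the subgradient at \<open>S k\<close>, tested at \<open>y\<close>, is used.\<close>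
  have main: "grad (x - y) \<bullet> e - V k \<bullet> e \<le> \<phi>r z - \<phi>r y + C * T k powr (p - 1)" for k
  proof -
    have "Q x y \<le> Q x (S k)" using y S(1) by (simp add: minimizer_def edom_F)
    then have opt: "fr y + \<phi>r y + norm (x - y) powr p / (r * p)
        \<le> fr (S k) + \<phi>r (S k) + norm (x - S k) powr p / (r * p)"
      by (simp add: Q_def real_F S(1) y_in)
    have Tp: "norm (T k *\<^sub>R e) powr p = T k * (T k powr (p - 1) * norm e powr p)"
      using T[of k] by (simp add: powr_mult powr_diff)
    have sub: "fr (S k) - T k * (V k \<bullet> e) - \<rho> / p * (T k * (T k powr (p - 1) * norm e powr p)) \<le> fr y"
      using subgradient_ineq[OF V(1) S(1) y_in, of k] Tp by (simp add: Se norm_minus_commute)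
    have "norm (x - S k) powr p \<le> norm (x - y) powr p
        + p * norm (x - y) powr (p - 2) * ((x - y) \<bullet> (- (T k *\<^sub>R e))) + (1 + p) * norm (T k *\<^sub>R e) powr p"
      using norm_add_powr_le[OF p, of "x - y" "- (T k *\<^sub>R e)"] by (simp add: Se algebra_simps)
    then have "norm (x - S k) powr p / (r * p) \<le> (norm (x - y) powr p
        + p * norm (x - y) powr (p - 2) * ((x - y) \<bullet> (- (T k *\<^sub>R e))) + (1 + p) * norm (T k *\<^sub>R e) powr p) / (r * p)"
      using rp by (intro divide_right_mono) auto
    also have "\<dots> = norm (x - y) powr p / (r * p) - T k * (grad (x - y) \<bullet> e)
        + (1 + p) / (r * p) * (T k * (T k powr (p - 1) * norm e powr p))"
    proof -
      have "grad (x - y) \<bullet> e = norm (x - y) powr (p - 2) * ((x - y) \<bullet> e) / r"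
        by (simp add: grad_def)
      then show ?thesis unfolding Tp using p r by (simp add: field_simps del: inner_diff_left)
    qed
    finally have "0 \<le> T k * (\<phi>r z - \<phi>r y) + T k * (V k \<bullet> e) - T k * (grad (x - y) \<bullet> e)
        + (\<rho> / p + (1 + p) / (r * p)) * (T k * (T k powr (p - 1) * norm e powr p))"
      using opt sub S(2)[of k] unfolding distrib_right left_diff_distrib right_diff_distrib by linarith
    then have "0 \<le> T k * (\<phi>r z - \<phi>r y + V k \<bullet> e - grad (x - y) \<bullet> e + C * T k powr (p - 1))"
      by (simp add: C_def algebra_simps)
    then show ?thesis using T(1)[of k] by (simp add: zero_le_mult_iff)
  qed
  have "(\<lambda>k. T (\<sigma> k) powr (p - 1)) \<longlonglongrightarrow> 0"
    using p less_imp_le[OF T(1)] by (intro tendsto_zero_powrI[OF T\<sigma> tendsto_const]) auto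
  then have l2: "(\<lambda>k. \<phi>r z - \<phi>r y + C * T (\<sigma> k) powr (p - 1)) \<longlonglongrightarrow> \<phi>r z - \<phi>r y + C * 0"
    by (intro tendsto_intros)
  have l1: "(\<lambda>k. grad (x - y) \<bullet> e - V (\<sigma> k) \<bullet> e) \<longlonglongrightarrow> grad (x - y) \<bullet> e - v \<bullet> e"
    by (intro tendsto_intros V\<sigma>)
  have 1: "(grad (x - y) - v) \<bullet> (z - y) \<le> \<phi>r z - \<phi>r y"
    using LIMSEQ_le[OF l1 l2] main by (auto simp: e_def inner_diff_left)
  have 2: "norm v \<le> L"
    using tendsto_upperbound[OF tendsto_norm[OF V\<sigma>], of L] V(2) by simp
  \<comment> \<open>The subgradient inequalities at \<open>S (\<sigma> k)\<close>, tested at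
    \<open>x\<close>, pass to the limit by lower semicontinuity of f. This is all that is retained
    of v being a subgradient at \<open>y\<close>.\<close>
  have "y \<in> edom f \<and> real_of_ereal (f y) \<le> fr x - v \<bullet> (x - y) + \<rho> / p * norm (x - y) powr p"
  proof (rule closed_epi_limit[OF _ _ S\<sigma>])
    show "closed (epi (edom f) (\<lambda>x. real_of_ereal (f x)))"
      using f_lsc f_not_MInf by (intro closed_epi_liminf lower_semicontinuous_liminf)
    show "S (\<sigma> k) \<in> edom f" for k using f_eq[OF S(1)] by (simp add: edom_def)
    show "real_of_ereal (f (S (\<sigma> k)))
        \<le> fr x - V (\<sigma> k) \<bullet> (x - S (\<sigma> k)) + \<rho> / p * norm (x - S (\<sigma> k)) powr p" for k
      using subgradient_ineq[OF V(1) S(1) x, of "\<sigma> k"] by (simp add: fr_def)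
    show "(\<lambda>k. fr x - V (\<sigma> k) \<bullet> (x - S (\<sigma> k)) + \<rho> / p * norm (x - S (\<sigma> k)) powr p)
        \<longlonglongrightarrow> fr x - v \<bullet> (x - y) + \<rho> / p * norm (x - y) powr p"
      using p by (intro tendsto_intros tendsto_powr2 V\<sigma> S\<sigma>) auto
  qed
  then have "v \<bullet> (x - y) \<le> fr x - fr y + \<rho> / p * norm (x - y) powr p" by (simp add: fr_def)
  with 1 2 show ?thesis by (intro that)
qed

text \<open>The variational inequality of the prox point z is tested at \<open>y\<close>, the
  optimality of \<open>y\<close> at z; in the sum the values of \<phi> cancel, and Cauchy-Schwarz
  finishes. Since v is selected for this z, it depends on \<open>u\<close>.\<close>

lemma prox_step_norm_le:
  assumes y: "minimizer x y" and x: "x \<in> edom \<phi>" and \<gamma>: "0 < \<gamma>"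
  obtains v where "norm v \<le> L"
    "norm (prox \<gamma> \<phi> (x - \<gamma> *\<^sub>R u) - y) \<le> norm ((x - y) - \<gamma> *\<^sub>R grad (x - y) - \<gamma> *\<^sub>R (u - v))"
    "v \<bullet> (x - y) \<le> fr x - fr y + \<rho> / p * norm (x - y) powr p"
proof -
  define z where "z = prox \<gamma> \<phi> (x - \<gamma> *\<^sub>R u)"
  have z: "z \<in> edom \<phi>" unfolding z_def by (rule prox_in[OF \<gamma>])
  obtain v where v: "norm v \<le> L" "(grad (x - y) - v) \<bullet> (z - y) \<le> \<phi>r z - \<phi>r y"
    "v \<bullet> (x - y) \<le> fr x - fr y + \<rho> / p * norm (x - y) powr p"
    using minimizer_optimality[OF y z x] by blast
  let ?d = "(x - y) - \<gamma> *\<^sub>R grad (x - y) - \<gamma> *\<^sub>R (u - v)"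
  have "(x - \<gamma> *\<^sub>R u - z) \<bullet> (y - z) \<le> \<gamma> * (\<phi>r y - \<phi>r z)"
    unfolding z_def by (rule prox_variational[OF \<gamma> minimizer_in[OF y]])
  moreover have "\<gamma> * ((grad (x - y) - v) \<bullet> (z - y)) \<le> \<gamma> * (\<phi>r z - \<phi>r y)"
    using v(2) \<gamma> by (intro mult_left_mono) auto
  ultimately have "(x - \<gamma> *\<^sub>R u - z) \<bullet> (y - z) + (\<gamma> *\<^sub>R (grad (x - y) - v)) \<bullet> (z - y) \<le> 0"
    by (simp add: algebra_simps)
  moreover have "(x - \<gamma> *\<^sub>R u - z) \<bullet> (y - z) + (\<gamma> *\<^sub>R (grad (x - y) - v)) \<bullet> (z - y)
      = (z - y) \<bullet> (z - y) - ?d \<bullet> (z - y)"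
    by (simp add: inner_diff_left inner_diff_right scaleR_diff_right algebra_simps)
  ultimately have "(norm (z - y))\<^sup>2 \<le> ?d \<bullet> (z - y)" by (simp add: power2_norm_eq_inner)
  also have "\<dots> \<le> norm ?d * norm (z - y)" by (rule norm_cauchy_schwarz)
  finally have "norm (z - y) \<le> norm ?d"
    by (cases "norm (z - y) = 0") (auto simp: power2_eq_square mult_le_cancel_right)
  with v show ?thesis by (intro that) (auto simp: z_def)
qed

end

section \<open>One step of the method\<close>

context paraconvex_composite
begin

definition c3 :: real where
  "c3 = 2 powr (p - 1) * r powr (- (p / (2 - p)))
        + (1 / r - 2 * \<rho>) * r powr (- (2 * (p - 1) / (2 - p)))"

definition c4 :: real where "c4 = 2 powr p * (1 + 2 powr (p - 1) * p)"

definition \<kappa> :: real where "\<kappa> = 1 / r - 2 * \<rho>"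

lemma \<kappa>_pos: "0 < \<kappa>"
  using r r\<rho> \<rho> by (simp add: \<kappa>_def field_simps)

lemma c3_nonneg: "0 \<le> c3"
  using \<kappa>_pos unfolding c3_def \<kappa>_def by (intro add_nonneg_nonneg mult_nonneg_nonneg) auto

text \<open>The first two bounds are the error constants of the contracting case and of the case of
  small |x - y|; \<open>c4\<close> dominates both.\<close>

lemma c4_bounds: "2 powr p * (1 + p) \<le> c4" "2 powr p * 2 powr (p - 1) \<le> c4" "0 \<le> c4"
proof -
  have 1: "1 \<le> (2::real) powr (p - 1)" using p by (simp add: ge_one_powr_ge_zero)
  have "1 * p \<le> 2 powr (p - 1) * p" "2 powr (p - 1) * 1 \<le> 2 powr (p - 1) * p"
    using 1 p by (intro mult_right_mono mult_left_mono; simp)+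
  then have "1 + p \<le> 1 + 2 powr (p - 1) * p" "2 powr (p - 1) \<le> 1 + 2 powr (p - 1) * p"
    by linarith+
  then show "2 powr p * (1 + p) \<le> c4" "2 powr p * 2 powr (p - 1) \<le> c4" "0 \<le> c4"
    using p unfolding c4_def by (auto intro!: mult_left_mono)
qed

lemma norm_diff_powr_le:
  fixes u v :: 'a
  assumes "norm v \<le> L"
  shows "norm (u - v) powr p \<le> 2 powr (p - 1) * (norm u powr p + L powr p)"
proof -
  have "norm (u - v) \<le> norm u + L" using norm_triangle_ineq4[of u v] assms by linarith
  then have "norm (u - v) powr p \<le> (norm u + L) powr p" using p by (intro powr_mono2) auto
  also have "\<dots> \<le> 2 powr (p - 1) * (norm u powr p + L powr p)"
    using p L by (intro powr_add_le) auto
  finally show ?thesis .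
qed

text \<open>The bound is affine in \<open>u\<close> up to \<open>|u|\<^sup>p\<close>, with coefficients not depending on \<open>u\<close>, so that it
  can be integrated over the random subgradient \<open>u\<close> with mean \<open>v\<^sub>x\<close>. Its second part is the
  value of the integrated bound.\<close>

lemma prox_step_powr_bound:
  assumes y: "minimizer x y" and x: "x \<in> edom \<phi>" and \<gamma>: "0 < \<gamma>" and vx: "vx \<in> limiting_subdiff f x"
  obtains A B C where "0 \<le> C"
    "\<And>u. norm (prox \<gamma> \<phi> (x - \<gamma> *\<^sub>R u) - y) powr p \<le> A - B * (u \<bullet> (x - y)) + C * norm u powr p"
    "A - B * (vx \<bullet> (x - y)) + C * L powr p \<le> norm (x - y) powr p - \<gamma> * \<kappa> * norm (x - y) powr (2 * p - 2)
       + c3 * \<gamma> powr (p / (2 - p)) + c4 * L powr p * \<gamma> powr p"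
proof -
  define w a where "w = x - y" and "a = norm (x - y)"
  have a0: "0 \<le> a" by (simp add: a_def)
  have c3p: "0 \<le> c3 * \<gamma> powr (p / (2 - p))" using c3_nonneg by simp
  show ?thesis
  proof (cases "0 < a \<and> \<gamma> / r \<le> a powr (2 - p)")
    case True
    \<comment> \<open>The factor by which the step along \<open>grad w\<close> rescales w; the case
      assumption says exactly that it is nonnegative.\<close>
    define s where "s = 1 - \<gamma> * a powr (p - 2) / r"
    have "\<gamma> / r * a powr (p - 2) \<le> a powr (2 - p) * a powr (p - 2)"
      using True by (intro mult_right_mono) auto
    also have "\<dots> = 1" using True by (simp add: powr_add[symmetric])
    finally have s: "0 \<le> s" "s \<le> 1" using \<gamma> r by (auto simp: s_def)
    have sw: "w - \<gamma> *\<^sub>R grad w = s *\<^sub>R w"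
      by (simp add: s_def grad_def w_def a_def algebra_simps)
    \<comment> \<open>An upper bound for \<open>v \<bullet> w\<close> common to all v that can
      occur; it removes the dependence of v on \<open>u\<close>.\<close>
    define \<delta> where "\<delta> = fr x - fr y + \<rho> / p * a powr p"
    define B where "B = p * (s * a) powr (p - 2) * (s * \<gamma>)"
    have B: "0 \<le> B" unfolding B_def using p s \<gamma> by (intro mult_nonneg_nonneg) auto
    define C where "C = (1 + p) * (\<gamma> powr p * 2 powr (p - 1))"
    define A where "A = (s * a) powr p + B * \<delta> + C * L powr p"
    have C: "0 \<le> C" using p by (simp add: C_def)
    have bound: "norm (prox \<gamma> \<phi> (x - \<gamma> *\<^sub>R u) - y) powr p \<le> A - B * (u \<bullet> (x - y)) + C * norm u powr p" for u
    proof -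
      obtain v where v: "norm v \<le> L"
        "norm (prox \<gamma> \<phi> (x - \<gamma> *\<^sub>R u) - y) \<le> norm ((x - y) - \<gamma> *\<^sub>R grad (x - y) - \<gamma> *\<^sub>R (u - v))"
        "v \<bullet> (x - y) \<le> fr x - fr y + \<rho> / p * norm (x - y) powr p"
        using prox_step_norm_le[OF y x \<gamma>] by blast
      have "norm (prox \<gamma> \<phi> (x - \<gamma> *\<^sub>R u) - y) powr p \<le> norm (s *\<^sub>R w + - (\<gamma> *\<^sub>R (u - v))) powr p"
        using v(2) p sw by (intro powr_mono2) (auto simp: w_def)
      also have "\<dots> \<le> norm (s *\<^sub>R w) powr p
          + p * norm (s *\<^sub>R w) powr (p - 2) * ((s *\<^sub>R w) \<bullet> (- (\<gamma> *\<^sub>R (u - v))))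
          + (1 + p) * norm (- (\<gamma> *\<^sub>R (u - v))) powr p"
        by (rule norm_add_powr_le[OF p])
      also have "\<dots> = (s * a) powr p + B * (v \<bullet> w - u \<bullet> w) + (1 + p) * (\<gamma> powr p * norm (u - v) powr p)"
      proof -
        have "norm (s *\<^sub>R w) = s * a" "norm (- (\<gamma> *\<^sub>R (u - v))) = \<gamma> * norm (u - v)"
          using s \<gamma> by (simp_all add: a_def w_def)
        moreover have "(s *\<^sub>R w) \<bullet> (- (\<gamma> *\<^sub>R (u - v))) = s * \<gamma> * (v \<bullet> w - u \<bullet> w)"
          by (simp add: inner_diff_right inner_commute algebra_simps)
        ultimately show ?thesis using \<gamma> by (simp only: B_def) (simp add: powr_mult)
      qed
      also have "\<dots> \<le> (s * a) powr p + B * (\<delta> - u \<bullet> w)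
          + (1 + p) * (\<gamma> powr p * (2 powr (p - 1) * (norm u powr p + L powr p)))"
        using B v(3) p norm_diff_powr_le[OF v(1)]
        by (intro add_mono mult_left_mono) (auto simp: \<delta>_def a_def w_def)
      finally show ?thesis by (simp add: A_def C_def w_def algebra_simps)
    qed
    have "fr x + vx \<bullet> (y - x) - \<rho> / p * norm (y - x) powr p \<le> fr y"
      by (rule subgradient_ineq[OF vx x minimizer_in[OF y]])
    moreover have "vx \<bullet> (y - x) = - (vx \<bullet> w)" by (simp add: w_def inner_diff_right)
    \<comment> \<open>The values of f at \<open>x\<close> and \<open>y\<close> cancel here, and the
      two paraconvexity errors add up to the factor 2.\<close>
    ultimately have "\<delta> - vx \<bullet> w \<le> 2 * \<rho> / p * a powr p"
      by (simp add: \<delta>_def a_def norm_minus_commute)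
    then have "B * (\<delta> - vx \<bullet> w) \<le> B * (2 * \<rho> / p * a powr p)"
      using B by (rule mult_left_mono)
    also have "\<dots> = 2 * \<rho> * \<gamma> * (s powr (p - 1) * a powr (2 * p - 2))"
    proof (cases "s = 0")
      case False
      then have "s * s powr (p - 2) = s powr (p - 1)" using s by (simp add: powr_diff power2_eq_square)
      moreover have "a powr (p - 2) * a powr p = a powr (2 * p - 2)"
        by (simp add: powr_add[symmetric])
      moreover have "B * (2 * \<rho> / p * a powr p)
          = 2 * \<rho> * \<gamma> * ((s * s powr (p - 2)) * (a powr (p - 2) * a powr p))"
        using s a0 p by (simp add: B_def powr_mult)
      ultimately show ?thesis by simp
    qed (use p in \<open>simp add: B_def\<close>)
    also have "\<dots> \<le> 2 * \<rho> * \<gamma> * (1 * a powr (2 * p - 2))"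
      using s p \<rho> \<gamma> by (intro mult_left_mono mult_right_mono powr_le1) auto
    finally have 1: "B * (\<delta> - vx \<bullet> w) \<le> 2 * \<rho> * \<gamma> * a powr (2 * p - 2)" by simp
    \<comment> \<open>As 0 <= s <= 1 and p > 1, the p-th power decreases at least as much as its
      base, which yields the full gain 1/r.\<close>
    have "s powr p \<le> s" using powr_mono'[of 1 p s] s p by simp
    then have "s powr p * a powr p \<le> s * a powr p" by (intro mult_right_mono) auto
    moreover have "a powr (p - 2) * a powr p = a powr (2 * p - 2)"
      by (simp add: powr_add[symmetric])
    then have "s * a powr p = a powr p - \<gamma> / r * a powr (2 * p - 2)"
      by (simp add: s_def algebra_simps)
    ultimately have 2: "(s * a) powr p \<le> a powr p - \<gamma> / r * a powr (2 * p - 2)"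
      using s a0 by (simp add: powr_mult)
    \<comment> \<open>One copy stems from |v| <= L, inside \<open>A\<close>, the other from the
      moment of the random subgradient.\<close>
    have "C * L powr p + C * L powr p = 2 powr p * (1 + p) * (L powr p * \<gamma> powr p)"
      by (simp add: C_def powr_diff algebra_simps)
    also have "\<dots> \<le> c4 * (L powr p * \<gamma> powr p)"
      using c4_bounds(1) by (intro mult_right_mono) auto
    finally have 3: "C * L powr p + C * L powr p \<le> c4 * (L powr p * \<gamma> powr p)" .
    have "A - B * (vx \<bullet> w) + C * L powr p
        = (s * a) powr p + B * (\<delta> - vx \<bullet> w) + (C * L powr p + C * L powr p)"
      by (simp add: A_def algebra_simps)
    moreover have "\<gamma> * \<kappa> * a powr (2 * p - 2)
        = \<gamma> / r * a powr (2 * p - 2) - 2 * \<rho> * \<gamma> * a powr (2 * p - 2)"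
      by (simp add: \<kappa>_def algebra_simps)
    ultimately have "A - B * (vx \<bullet> w) + C * L powr p \<le> a powr p - \<gamma> * \<kappa> * a powr (2 * p - 2)
       + c3 * \<gamma> powr (p / (2 - p)) + c4 * L powr p * \<gamma> powr p"
      using 1 2 3 c3p by (simp add: mult.assoc)
    then show ?thesis using that[OF C bound] by (simp add: a_def w_def)
  next
    case False
    \<comment> \<open>The radius at which \<gamma> |w|^(p-2) = r. In this case both w and its image
      under the step along \<open>grad w\<close> have norm at most \<beta>.\<close>
    define \<beta> where "\<beta> = (\<gamma> / r) powr (1 / (2 - p))"
    have \<beta>: "0 < \<beta>" using \<gamma> r by (simp add: \<beta>_def)
    have \<beta>2: "\<beta> powr (2 - p) = \<gamma> / r" using \<gamma> r p by (simp add: \<beta>_def powr_powr)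
    have a_le: "a \<le> \<beta>"
    proof (rule ccontr)
      assume "\<not> a \<le> \<beta>"
      then have "\<beta> powr (2 - p) \<le> a powr (2 - p)" using \<beta> p by (intro powr_mono2) auto
      then show False using \<open>\<not> a \<le> \<beta>\<close> \<beta> \<beta>2 False by auto
    qed
    have near: "norm (w - \<gamma> *\<^sub>R grad w) \<le> \<beta>"
    proof (cases "a = 0")
      case True
      then show ?thesis using \<beta> by (simp add: w_def a_def grad_def)
    next
      case a: False
      define t where "t = \<gamma> * a powr (p - 2) / r"
      have "a powr (2 - p) * a powr (p - 2) \<le> \<gamma> / r * a powr (p - 2)"
        using False a a0 by (intro mult_right_mono) auto
      moreover have "a powr (2 - p) * a powr (p - 2) = 1" using a a0 by (simp add: powr_add[symmetric])
      ultimately have t: "1 \<le> t" by (simp add: t_def)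
      have "w - \<gamma> *\<^sub>R grad w = (1 - t) *\<^sub>R w"
        by (simp add: t_def grad_def w_def a_def algebra_simps)
      then have "norm (w - \<gamma> *\<^sub>R grad w) = (t - 1) * a" using t by (simp add: a_def w_def)
      also have "\<dots> \<le> t * a" using a0 by (simp add: algebra_simps)
      also have "\<dots> = \<gamma> / r * a powr (p - 1)"
        using a a0 by (simp add: t_def powr_diff power2_eq_square)
      also have "\<dots> \<le> \<gamma> / r * \<beta> powr (p - 1)"
        using a_le a0 p \<gamma> r by (intro mult_left_mono powr_mono2) auto
      also have "\<dots> = \<beta>" unfolding \<beta>2[symmetric] using \<beta> by (simp add: powr_add[symmetric])
      finally show ?thesis .
    qed
    define C where "C = 2 powr (p - 1) * (\<gamma> powr p * 2 powr (p - 1))"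
    define A where "A = 2 powr (p - 1) * \<beta> powr p + C * L powr p"
    have C: "0 \<le> C" by (simp add: C_def)
    have bound: "norm (prox \<gamma> \<phi> (x - \<gamma> *\<^sub>R u) - y) powr p \<le> A - 0 * (u \<bullet> (x - y)) + C * norm u powr p" for u
    proof -
      obtain v where v: "norm v \<le> L"
        "norm (prox \<gamma> \<phi> (x - \<gamma> *\<^sub>R u) - y) \<le> norm ((x - y) - \<gamma> *\<^sub>R grad (x - y) - \<gamma> *\<^sub>R (u - v))"
        using prox_step_norm_le[OF y x \<gamma>] by blast
      have "norm ((x - y) - \<gamma> *\<^sub>R grad (x - y) - \<gamma> *\<^sub>R (u - v)) \<le> \<beta> + \<gamma> * norm (u - v)"
        using norm_triangle_ineq4[of "w - \<gamma> *\<^sub>R grad w" "\<gamma> *\<^sub>R (u - v)"] near \<gamma> by (simp add: w_def)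
      then have "norm (prox \<gamma> \<phi> (x - \<gamma> *\<^sub>R u) - y) powr p \<le> (\<beta> + \<gamma> * norm (u - v)) powr p"
        using v(2) p by (intro powr_mono2) auto
      also have "\<dots> \<le> 2 powr (p - 1) * (\<beta> powr p + (\<gamma> * norm (u - v)) powr p)"
        using p \<beta> \<gamma> by (intro powr_add_le) auto
      also have "\<dots> = 2 powr (p - 1) * (\<beta> powr p + \<gamma> powr p * norm (u - v) powr p)"
        using \<gamma> by (simp add: powr_mult)
      also have "\<dots> \<le> 2 powr (p - 1) * (\<beta> powr p
          + \<gamma> powr p * (2 powr (p - 1) * (norm u powr p + L powr p)))"
        using norm_diff_powr_le[OF v(1), of u] by (intro mult_left_mono add_left_mono) auto
      finally show ?thesis by (simp add: A_def C_def algebra_simps)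
    qed
    have "C * L powr p + C * L powr p = 2 powr p * 2 powr (p - 1) * (L powr p * \<gamma> powr p)"
      by (simp add: C_def powr_diff algebra_simps)
    also have "\<dots> \<le> c4 * (L powr p * \<gamma> powr p)"
      using c4_bounds(2) by (intro mult_right_mono) auto
    finally have 1: "C * L powr p + C * L powr p \<le> c4 * (L powr p * \<gamma> powr p)" .
    have divp: "(\<gamma> / r) powr q = \<gamma> powr q * r powr (- q)" for q
      using \<gamma> r by (simp add: powr_divide powr_minus_divide)
    \<comment> \<open>No descent is extracted here, so the subtracted term has to be paid for. Its
      bound \<gamma> \<kappa> \<beta>^(2p-2) and the term 2^(p-1) \<beta>^p are multiples of
      \<gamma>^(p/(2-p)), and their coefficients are the two summands of \<open>c3\<close>.\<close>
    have "a powr (2 * p - 2) \<le> \<beta> powr (2 * p - 2)" using a_le a0 p by (intro powr_mono2) auto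
    then have "\<gamma> * \<kappa> * a powr (2 * p - 2) \<le> \<gamma> * \<kappa> * \<beta> powr (2 * p - 2)"
      using \<gamma> \<kappa>_pos by (intro mult_left_mono) auto
    moreover have "\<gamma> * \<beta> powr (2 * p - 2) = r powr (- (2 * (p - 1) / (2 - p))) * \<gamma> powr (p / (2 - p))"
    proof -
      have e: "p / (2 - p) = 1 + 2 * (p - 1) / (2 - p)" using p by (simp add: field_simps)
      have "1 / (2 - p) * (2 * p - 2) = 2 * (p - 1) / (2 - p)" by simp
      then have "\<beta> powr (2 * p - 2) = (\<gamma> / r) powr (2 * (p - 1) / (2 - p))"
        by (simp only: \<beta>_def powr_powr)
      also have "\<dots> = \<gamma> powr (2 * (p - 1) / (2 - p)) * r powr (- (2 * (p - 1) / (2 - p)))"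
        by (rule divp)
      finally show ?thesis unfolding e using \<gamma> by (simp add: powr_add)
    qed
    moreover have "\<beta> powr p = r powr (- (p / (2 - p))) * \<gamma> powr (p / (2 - p))"
      unfolding \<beta>_def powr_powr using divp[of "p / (2 - p)"] by simp
    moreover have "\<gamma> * \<kappa> * \<beta> powr (2 * p - 2) = \<kappa> * (\<gamma> * \<beta> powr (2 * p - 2))" by simp
    moreover have "c3 * \<gamma> powr (p / (2 - p)) = 2 powr (p - 1) * (r powr (- (p / (2 - p))) * \<gamma> powr (p / (2 - p)))
        + \<kappa> * (r powr (- (2 * (p - 1) / (2 - p))) * \<gamma> powr (p / (2 - p)))"
      by (simp add: c3_def \<kappa>_def distrib_right mult.assoc)
    ultimately have "2 powr (p - 1) * \<beta> powr p + \<gamma> * \<kappa> * a powr (2 * p - 2) \<le> c3 * \<gamma> powr (p / (2 - p))"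
      by simp
    moreover have "0 \<le> a powr p" by simp
    ultimately have "A - 0 * (vx \<bullet> w) + C * L powr p \<le> a powr p - \<gamma> * \<kappa> * a powr (2 * p - 2)
       + c3 * \<gamma> powr (p / (2 - p)) + c4 * L powr p * \<gamma> powr p"
      using 1 unfolding A_def mult.assoc[of c4] by linarith
    then show ?thesis using that[OF C bound] by (simp add: a_def w_def)
  qed
qed

end

section \<open>Integration over the sample paths\<close>

text \<open>Jensen's inequality, obtained by integrating the tangent of t^(1/p) at
  \<open>L powr p\<close>. The bound on the mean supplies the bounded subgradients of f.\<close>

lemma (in prob_space) norm_expectation_le_of_powr_moment:
  fixes X :: "'a \<Rightarrow> 'b::{banach, second_countable_topology}"
  assumes X: "integrable M X" and p: "1 < p" and L: "0 < L"
    and moment: "(\<integral>\<^sup>+\<omega>. ennreal (norm (X \<omega>) powr p) \<partial>M) \<le> ennreal (L powr p)"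
  shows "integrable M (\<lambda>\<omega>. norm (X \<omega>) powr p)"
    and "(\<integral>\<omega>. norm (X \<omega>) powr p \<partial>M) \<le> L powr p"
    and "norm (\<integral>\<omega>. X \<omega> \<partial>M) \<le> L"
proof -
  have [measurable]: "X \<in> borel_measurable M" using X by simp
  show int: "integrable M (\<lambda>\<omega>. norm (X \<omega>) powr p)"
    using moment by (intro integrableI_bounded) (auto intro: le_less_trans[OF _ ennreal_less_top])
  show le: "(\<integral>\<omega>. norm (X \<omega>) powr p \<partial>M) \<le> L powr p"
    using moment nn_integral_eq_integral[OF int] by (simp add: ennreal_le_iff)
  have "norm (\<integral>\<omega>. X \<omega> \<partial>M) \<le> (\<integral>\<omega>. norm (X \<omega>) \<partial>M)"
    by (rule integral_norm_bound)
  also have "\<dots> \<le> (\<integral>\<omega>. L + 1 / p * L powr (1 - p) * (norm (X \<omega>) powr p - L powr p) \<partial>M)"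
  proof (intro integral_mono)
    show "norm (X \<omega>) \<le> L + 1 / p * L powr (1 - p) * (norm (X \<omega>) powr p - L powr p)" for \<omega>
      using powr_le_tangent[of "norm (X \<omega>) powr p" "L powr p" "1 / p"] p L
      by (simp add: powr_powr algebra_simps)
  qed (use X int in auto)
  also have "\<dots> = L + 1 / p * L powr (1 - p) * ((\<integral>\<omega>. norm (X \<omega>) powr p \<partial>M) - L powr p)"
    using int by (simp add: prob_space)
  also have "\<dots> \<le> L"
    using mult_nonneg_nonpos[of "1 / p * L powr (1 - p)" "(\<integral>\<omega>. norm (X \<omega>) powr p \<partial>M) - L powr p"] le p
    by simp
  finally show "norm (\<integral>\<omega>. X \<omega> \<partial>M) \<le> L" .
qed

locale stochastic_prox_subgradient =
  paraconvex_composite \<phi> f p r Fmin \<rho> L + \<pi>: prob_space \<pi>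
  for \<phi> f :: "'a::euclidean_space \<Rightarrow> ereal" and p r Fmin \<rho> L :: real and \<pi> :: "'o measure" +
  fixes U :: "'a set" and g :: "'a \<Rightarrow> 'o \<Rightarrow> 'a" and \<gamma> :: "nat \<Rightarrow> real" and x0 :: 'a
  assumes U: "open U" "edom \<phi> \<subseteq> U"
    and g_measurable: "(\<lambda>(x, \<xi>). g x \<xi>) \<in> borel_measurable (restrict_space borel U \<Otimes>\<^sub>M \<pi>)"
    and g_integrable: "\<And>x. x \<in> edom \<phi> \<Longrightarrow> integrable \<pi> (g x)"
    and g_mean: "\<And>x. x \<in> edom \<phi> \<Longrightarrow> (\<integral>\<zeta>. g x \<zeta> \<partial>\<pi>) \<in> limiting_subdiff f x"
    and g_moment: "\<And>x. x \<in> edom \<phi> \<Longrightarrow>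
      (\<integral>\<^sup>+\<zeta>. ennreal (norm (g x \<zeta>) powr p) \<partial>\<pi>) \<le> ennreal (L powr p)"
    and x0: "x0 \<in> edom \<phi>" and \<gamma>: "\<And>t. 0 < \<gamma> t"
begin

definition h :: "'a \<Rightarrow> real" where "h x = m x - Fmin"

definition K :: "nat \<Rightarrow> real" where
  "K t = (c3 * \<gamma> t powr (p / (2 - p)) + c4 * L powr p * \<gamma> t powr p) / (r * p)"

definition step :: "nat \<Rightarrow> 'a \<Rightarrow> 'o \<Rightarrow> 'a" where
  "step t x \<zeta> = prox (\<gamma> t) \<phi> (x - \<gamma> t *\<^sub>R g x \<zeta>)"

text \<open>The iterates as functions of the sample sequence itself, so that expectations are
  computed on the product space; substituting the actual samples recovers the method.\<close>

definition X :: "nat \<Rightarrow> (nat \<Rightarrow> 'o) \<Rightarrow> 'a" where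
  "X = prox_subgrad \<phi> g \<gamma> x0 (\<lambda>t s. s t)"

abbreviation paths :: "(nat \<Rightarrow> 'o) measure" where "paths \<equiv> Pi\<^sub>M UNIV (\<lambda>_. \<pi>)"

lemma h_nonneg: "0 \<le> h x"
  using Fmin_le_m by (simp add: h_def)

lemma K_nonneg: "0 \<le> K t"
  unfolding K_def using c3_nonneg c4_bounds(3) p r
  by (intro divide_nonneg_nonneg add_nonneg_nonneg mult_nonneg_nonneg) auto

lemma h_measurable [measurable]: "h \<in> borel_measurable borel"
  unfolding h_def[abs_def]
  by (intro borel_measurable_diff borel_measurable_continuous_onI continuous_m) auto

text \<open>The minimizer is fixed before the sample is drawn and serves as competitor at the new
  point. This gives an integrable majorant of \<open>h\<close> whose integral is controlled by the
  mean and the p-th moment of the oracle.\<close>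

lemma step_descent:
  assumes x: "x \<in> edom \<phi>" and y: "minimizer x y"
  shows "(\<integral>\<^sup>+\<zeta>. ennreal (h (step t x \<zeta>)) \<partial>\<pi>)
           + ennreal (\<gamma> t * \<kappa> * norm (x - y) powr (2 * p - 2) / (r * p)) \<le> ennreal (h x + K t)"
proof -
  have rp: "0 < r * p" using p r by simp
  define a where "a = norm (x - y)"
  obtain A B C where C: "0 \<le> C" and
    bound: "\<And>u. norm (prox (\<gamma> t) \<phi> (x - \<gamma> t *\<^sub>R u) - y) powr p \<le> A - B * (u \<bullet> (x - y)) + C * norm u powr p"
    and mean: "A - B * ((\<integral>\<zeta>. g x \<zeta> \<partial>\<pi>) \<bullet> (x - y)) + C * L powr p
       \<le> a powr p - \<gamma> t * \<kappa> * a powr (2 * p - 2) + c3 * \<gamma> t powr (p / (2 - p)) + c4 * L powr p * \<gamma> t powr p"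
    unfolding a_def by (rule prox_step_powr_bound[OF y x \<gamma>[of t] g_mean[OF x]]) (rule that[unfolded a_def]; assumption)
  define R where "R \<zeta> = h x + (A - B * (g x \<zeta> \<bullet> (x - y)) + C * norm (g x \<zeta>) powr p - a powr p) / (r * p)" for \<zeta>
  have moments: "integrable \<pi> (\<lambda>\<zeta>. norm (g x \<zeta>) powr p)" "(\<integral>\<zeta>. norm (g x \<zeta>) powr p \<partial>\<pi>) \<le> L powr p"
    using \<pi>.norm_expectation_le_of_powr_moment[OF g_integrable[OF x] p(1) L g_moment[OF x]] by auto
  have int_R: "integrable \<pi> R"
    unfolding R_def using moments(1) g_integrable[OF x] by auto
  have hR: "h (step t x \<zeta>) \<le> R \<zeta>" for \<zeta>
  proof -
    have "m (step t x \<zeta>) \<le> Q (step t x \<zeta>) y" using y by (intro m_le) (simp add: minimizer_def)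
    moreover have "norm (step t x \<zeta> - y) powr p / (r * p)
        \<le> (A - B * (g x \<zeta> \<bullet> (x - y)) + C * norm (g x \<zeta>) powr p) / (r * p)"
      using bound[of "g x \<zeta>"] rp by (intro divide_right_mono) (auto simp: step_def)
    ultimately show ?thesis
      using m_eq[OF y] by (simp add: h_def R_def Q_def a_def diff_divide_distrib)
  qed
  have "(\<integral>\<zeta>. R \<zeta> \<partial>\<pi>) = h x + (A - B * ((\<integral>\<zeta>. g x \<zeta> \<partial>\<pi>) \<bullet> (x - y))
      + C * (\<integral>\<zeta>. norm (g x \<zeta>) powr p \<partial>\<pi>) - a powr p) / (r * p)"
    unfolding R_def using moments(1) g_integrable[OF x] by (simp add: \<pi>.prob_space)
  also have "\<dots> \<le> h x + (A - B * ((\<integral>\<zeta>. g x \<zeta> \<partial>\<pi>) \<bullet> (x - y)) + C * L powr p - a powr p) / (r * p)"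
    using rp C moments(2) by (intro add_left_mono divide_right_mono) (auto intro: mult_left_mono)
  also have "\<dots> \<le> h x + (- (\<gamma> t * \<kappa> * a powr (2 * p - 2)) + c3 * \<gamma> t powr (p / (2 - p))
      + c4 * L powr p * \<gamma> t powr p) / (r * p)"
    using rp mean by (intro add_left_mono divide_right_mono) auto
  also have "\<dots> = h x + K t - \<gamma> t * \<kappa> * a powr (2 * p - 2) / (r * p)"
    by (simp add: K_def add_divide_distrib diff_divide_distrib)
  finally have int_le: "(\<integral>\<zeta>. R \<zeta> \<partial>\<pi>) + \<gamma> t * \<kappa> * a powr (2 * p - 2) / (r * p) \<le> h x + K t" by simp
  have R0: "0 \<le> R \<zeta>" for \<zeta> using hR[of \<zeta>] h_nonneg[of "step t x \<zeta>"] by linarith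
  have "(\<integral>\<^sup>+\<zeta>. ennreal (h (step t x \<zeta>)) \<partial>\<pi>) \<le> (\<integral>\<^sup>+\<zeta>. ennreal (R \<zeta>) \<partial>\<pi>)"
    using hR by (intro nn_integral_mono ennreal_leI)
  also have "\<dots> = ennreal (\<integral>\<zeta>. R \<zeta> \<partial>\<pi>)"
    using int_R R0 by (intro nn_integral_eq_integral) auto
  finally have "(\<integral>\<^sup>+\<zeta>. ennreal (h (step t x \<zeta>)) \<partial>\<pi>)
      + ennreal (\<gamma> t * \<kappa> * a powr (2 * p - 2) / (r * p))
      \<le> ennreal (\<integral>\<zeta>. R \<zeta> \<partial>\<pi>) + ennreal (\<gamma> t * \<kappa> * a powr (2 * p - 2) / (r * p))"
    by (rule add_right_mono)
  also have "\<dots> = ennreal ((\<integral>\<zeta>. R \<zeta> \<partial>\<pi>) + \<gamma> t * \<kappa> * a powr (2 * p - 2) / (r * p))"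
    using R0 rp \<kappa>_pos \<gamma>[of t] by (intro ennreal_plus[symmetric] integral_nonneg) auto
  also have "\<dots> \<le> ennreal (h x + K t)" using int_le by (rule ennreal_leI)
  finally show ?thesis by (simp add: a_def)
qed

definition E_step :: "nat \<Rightarrow> 'a \<Rightarrow> ennreal" where
  "E_step t x = (\<integral>\<^sup>+\<zeta>. ennreal (h (step t x \<zeta>)) \<partial>\<pi>)"

text \<open>Subtraction in \<open>ennreal\<close> truncates at 0. On the domain of \<phi> the error
  \<open>K t\<close> keeps the difference nonnegative by \<open>step_descent\<close>, so nothing is
  lost.\<close>

definition gap :: "nat \<Rightarrow> 'a \<Rightarrow> ennreal" where
  "gap t x = ennreal (h x + K t) - E_step t x"

lemma gap_add_E_step: "x \<in> edom \<phi> \<Longrightarrow> gap t x + E_step t x = ennreal (h x + K t)"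
proof -
  assume x: "x \<in> edom \<phi>"
  obtain y where "minimizer x y" using minimizer_exists by blast
  from step_descent[OF x this, of t] have "E_step t x \<le> ennreal (h x + K t)"
    unfolding E_step_def by (metis le_iff_add add.assoc)
  then show ?thesis by (simp add: gap_def diff_add_cancel_ennreal)
qed

text \<open>Descent is applied to the minimizer that provides the limiting subgradient. The factor
  arises from \<kappa> = (1 - 2 \<rho> r)/r: multiplied by \<kappa>/(r p) it gives 1/r^2.\<close>

lemma dist_zero_le_gap:
  assumes x: "x \<in> edom \<phi>"
  shows "ennreal (\<gamma> t) * (dist_zero (limiting_subdiff (moreau_env p r (\<lambda>y. f y + \<phi> y)) x))\<^sup>2
           \<le> ennreal (p / (1 - 2 * \<rho> * r)) * gap t x"
proof -
  obtain y where y: "minimizer x y"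
    "dist_zero (limiting_subdiff (moreau_env p r (\<lambda>y. f y + \<phi> y)) x) \<le> ennreal (norm (x - y) powr (p - 1) / r)"
    using dist_zero_limiting_subdiff_le by blast
  have \<rho>r: "0 < 1 - 2 * \<rho> * r" using r\<rho> \<rho> by (simp add: field_simps)
  define c where "c = \<gamma> t * \<kappa> * norm (x - y) powr (2 * p - 2) / (r * p)"
  have c0: "0 \<le> c" using \<gamma>[of t] \<kappa>_pos p r by (simp add: c_def)
  have "E_step t x < top"
    using step_descent[OF x y(1), of t] unfolding E_step_def
    by (metis add.commute ennreal_less_top le_iff_add order_le_less_trans)
  then have "ennreal c = E_step t x + ennreal c - E_step t x" by simp
  also have "\<dots> \<le> gap t x"
    unfolding gap_def using step_descent[OF x y(1), of t]
    by (intro ennreal_minus_mono) (auto simp: E_step_def c_def)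
  finally have c_le: "ennreal c \<le> gap t x" .
  have "(dist_zero (limiting_subdiff (moreau_env p r (\<lambda>y. f y + \<phi> y)) x))\<^sup>2
      \<le> (ennreal (norm (x - y) powr (p - 1) / r))\<^sup>2"
    using y(2) by (intro power_mono) auto
  also have "\<dots> = ennreal ((norm (x - y) powr (p - 1) / r)\<^sup>2)"
    using r by (simp add: ennreal_power)
  also have "(norm (x - y) powr (p - 1) / r)\<^sup>2 = norm (x - y) powr (2 * p - 2) / r\<^sup>2"
    by (simp add: power_divide power2_eq_square powr_add[symmetric])
  finally have "ennreal (\<gamma> t) * (dist_zero (limiting_subdiff (moreau_env p r (\<lambda>y. f y + \<phi> y)) x))\<^sup>2
      \<le> ennreal (\<gamma> t) * ennreal (norm (x - y) powr (2 * p - 2) / r\<^sup>2)"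
    by (intro mult_left_mono) auto
  also have "\<dots> = ennreal (p / (1 - 2 * \<rho> * r) * c)"
  proof -
    have "\<kappa> = (1 - 2 * \<rho> * r) / r" using r by (simp add: \<kappa>_def field_simps)
    then have "\<gamma> t * (norm (x - y) powr (2 * p - 2) / r\<^sup>2) = p / (1 - 2 * \<rho> * r) * c"
      using \<rho>r p r by (simp add: c_def power2_eq_square)
    then show ?thesis using less_imp_le[OF \<gamma>[of t]] by (simp add: ennreal_mult'[symmetric])
  qed
  also have "\<dots> = ennreal (p / (1 - 2 * \<rho> * r)) * ennreal c"
    using c0 p \<rho>r by (intro ennreal_mult) auto
  also have "\<dots> \<le> ennreal (p / (1 - 2 * \<rho> * r)) * gap t x"
    using c_le by (intro mult_left_mono) auto
  finally show ?thesis .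
qed

lemma X_0 [simp]: "X 0 s = x0"
  by (simp add: X_def)

lemma X_Suc: "X (Suc t) s = step t (X t s) (s t)"
  by (simp add: X_def step_def Let_def)

lemma X_in: "X t s \<in> edom \<phi>"
  by (cases t) (auto simp: x0 X_Suc step_def intro!: prox_in \<gamma>)

text \<open>Adaptedness: iterate t reads only samples with index below t, so a later coordinate can
  be redrawn freely.\<close>

lemma X_fun_upd: "t \<le> k \<Longrightarrow> X t (s(k := \<zeta>)) = X t s"
  by (induction t) (auto simp: X_Suc)

text \<open>\<open>g\<close> is jointly measurable only over \<open>U\<close>, so the current point
  is first regarded as a map into the restricted space.\<close>

lemma step_measurable:
  assumes Y: "Y \<in> borel_measurable N" "\<And>s. s \<in> space N \<Longrightarrow> Y s \<in> edom \<phi>" and Z: "Z \<in> measurable N \<pi>"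
  shows "(\<lambda>s. step t (Y s) (Z s)) \<in> borel_measurable N"
proof -
  have "Y \<in> measurable N (restrict_space borel U)"
    using Y U(2) by (intro measurable_restrict_space2) auto
  then have "(\<lambda>s. (Y s, Z s)) \<in> measurable N (restrict_space borel U \<Otimes>\<^sub>M \<pi>)"
    using Z by (intro measurable_Pair) auto
  from measurable_compose[OF this g_measurable]
  have [measurable]: "(\<lambda>s. g (Y s) (Z s)) \<in> borel_measurable N" by simp
  have [measurable]: "prox (\<gamma> t) \<phi> \<in> borel_measurable borel"
    by (intro borel_measurable_continuous_onI continuous_prox \<gamma>)
  show ?thesis unfolding step_def using Y(1) by measurable
qed

lemma X_measurable [measurable]: "X t \<in> borel_measurable paths"
proof (induction t)
  case (Suc t)
  then show ?case unfolding X_Suc[abs_def] by (intro step_measurable X_in) auto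
qed (simp add: X_0[abs_def])

lemma step_X_measurable:
  "(\<lambda>(s, \<zeta>). h (step t (X t s) \<zeta>)) \<in> borel_measurable (paths \<Otimes>\<^sub>M \<pi>)"
proof -
  have "(\<lambda>z. step t (X t (fst z)) (snd z)) \<in> borel_measurable (paths \<Otimes>\<^sub>M \<pi>)"
    by (intro step_measurable X_in) auto
  then show ?thesis by (simp add: split_beta')
qed

lemma E_step_measurable [measurable]: "(\<lambda>s. E_step t (X t s)) \<in> borel_measurable paths"
  unfolding E_step_def
  using step_X_measurable[of t] by (intro \<pi>.borel_measurable_nn_integral) (simp add: split_beta')

lemma gap_measurable [measurable]: "(\<lambda>s. gap t (X t s)) \<in> borel_measurable paths"
  unfolding gap_def by measurable

lemma prob_space_paths: "prob_space paths"
  by (intro prob_space_PiM \<pi>.prob_space_axioms)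

text \<open>Redrawing coordinate t independently preserves the product measure and leaves
  \<open>X t\<close> unchanged. Fubini then takes the place of conditioning on the past.\<close>

lemma nn_integral_X_Suc: "(\<integral>\<^sup>+s. ennreal (h (X (Suc t) s)) \<partial>paths) = (\<integral>\<^sup>+s. E_step t (X t s) \<partial>paths)"
proof -
  interpret paths: prob_space paths by (rule prob_space_paths)
  interpret pair_sigma_finite \<pi> paths ..
  have upd: "(\<lambda>(\<zeta>, s). s(t := \<zeta>)) \<in> measurable (\<pi> \<Otimes>\<^sub>M paths) paths"
    by (auto simp: split_beta' intro!: measurable_fun_upd[where J=UNIV])
  have "distr (\<pi> \<Otimes>\<^sub>M paths) paths (\<lambda>(\<zeta>, s). s(t := \<zeta>)) = paths"
    using distr_pair_PiM_eq_PiM[of UNIV "\<lambda>_. \<pi>" t] \<pi>.prob_space_axioms by simp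
  then have "(\<integral>\<^sup>+s. ennreal (h (X (Suc t) s)) \<partial>paths)
      = (\<integral>\<^sup>+s. ennreal (h (X (Suc t) s)) \<partial>distr (\<pi> \<Otimes>\<^sub>M paths) paths (\<lambda>(\<zeta>, s). s(t := \<zeta>)))"
    by simp
  also have "\<dots> = (\<integral>\<^sup>+z. ennreal (h (X (Suc t) ((snd z)(t := fst z)))) \<partial>(\<pi> \<Otimes>\<^sub>M paths))"
    using upd by (subst nn_integral_distr) (auto simp: split_beta')
  also have "\<dots> = (\<integral>\<^sup>+z. ennreal (h (step t (X t (snd z)) (fst z))) \<partial>(\<pi> \<Otimes>\<^sub>M paths))"
    by (simp add: X_Suc X_fun_upd)
  also have "\<dots> = (\<integral>\<^sup>+s. \<integral>\<^sup>+\<zeta>. ennreal (h (step t (X t s) \<zeta>)) \<partial>\<pi> \<partial>paths)"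
  proof -
    have "(\<lambda>z. step t (X t (snd z)) (fst z)) \<in> borel_measurable (\<pi> \<Otimes>\<^sub>M paths)"
      by (intro step_measurable X_in) auto
    then show ?thesis by (subst nn_integral_snd[symmetric]) (auto simp: split_beta')
  qed
  finally show ?thesis by (simp add: E_step_def)
qed

text \<open>Because \<open>gap\<close> is the exact slack, this is an identity, and the induction
  needs only addition in \<open>ennreal\<close>.\<close>

lemma gap_telescope:
  "(\<Sum>t<n. \<integral>\<^sup>+s. gap t (X t s) \<partial>paths) + (\<integral>\<^sup>+s. ennreal (h (X n s)) \<partial>paths) = ennreal (h x0) + (\<Sum>t<n. ennreal (K t))"
proof (induction n)
  case 0
  interpret paths: prob_space paths by (rule prob_space_paths)
  show ?case by (simp add: paths.emeasure_space_1)
next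
  case (Suc n)
  interpret paths: prob_space paths by (rule prob_space_paths)
  have "(\<integral>\<^sup>+s. gap n (X n s) \<partial>paths) + (\<integral>\<^sup>+s. ennreal (h (X (Suc n) s)) \<partial>paths)
      = (\<integral>\<^sup>+s. gap n (X n s) + E_step n (X n s) \<partial>paths)"
    unfolding nn_integral_X_Suc by (rule nn_integral_add[symmetric]) auto
  also have "\<dots> = (\<integral>\<^sup>+s. ennreal (h (X n s)) + ennreal (K n) \<partial>paths)"
    by (simp add: gap_add_E_step[OF X_in] h_nonneg K_nonneg)
  also have "\<dots> = (\<integral>\<^sup>+s. ennreal (h (X n s)) \<partial>paths) + ennreal (K n)"
    by (subst nn_integral_add) (auto simp: paths.emeasure_space_1)
  finally have "(\<Sum>t<Suc n. \<integral>\<^sup>+s. gap t (X t s) \<partial>paths) + (\<integral>\<^sup>+s. ennreal (h (X (Suc n) s)) \<partial>paths)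
      = ((\<Sum>t<n. \<integral>\<^sup>+s. gap t (X t s) \<partial>paths) + (\<integral>\<^sup>+s. ennreal (h (X n s)) \<partial>paths)) + ennreal (K n)"
    by (simp only: sum.lessThan_Suc add.assoc)
  also have "\<dots> = ennreal (h x0) + (\<Sum>t<Suc n. ennreal (K t))"
    unfolding Suc by (simp only: sum.lessThan_Suc add.assoc)
  finally show ?case .
qed

lemma sum_gap_le:
  "(\<Sum>t<n. \<integral>\<^sup>+s. ennreal (p / (1 - 2 * \<rho> * r)) * gap t (X t s) \<partial>paths)
     \<le> ennreal (p / (1 - 2 * \<rho> * r) * (m x0 - Fmin)
         + c3 / (r * (1 - 2 * \<rho> * r)) * (\<Sum>t<n. \<gamma> t powr (p / (2 - p)))
         + c4 * L powr p / (r * (1 - 2 * \<rho> * r)) * (\<Sum>t<n. \<gamma> t powr p))"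
proof -
  have \<rho>r: "0 < 1 - 2 * \<rho> * r" using r\<rho> \<rho> by (simp add: field_simps)
  have "(\<Sum>t<n. \<integral>\<^sup>+s. ennreal (p / (1 - 2 * \<rho> * r)) * gap t (X t s) \<partial>paths)
      = ennreal (p / (1 - 2 * \<rho> * r)) * (\<Sum>t<n. \<integral>\<^sup>+s. gap t (X t s) \<partial>paths)"
    by (simp add: nn_integral_cmult sum_distrib_left)
  also have "\<dots> \<le> ennreal (p / (1 - 2 * \<rho> * r)) * (ennreal (h x0) + (\<Sum>t<n. ennreal (K t)))"
    unfolding gap_telescope[symmetric] by (intro mult_left_mono) auto
  also have "\<dots> = ennreal (p / (1 - 2 * \<rho> * r) * (h x0 + (\<Sum>t<n. K t)))"
    using h_nonneg K_nonneg \<rho>r p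
    by (simp add: sum_ennreal sum_nonneg ennreal_mult'[symmetric] ennreal_plus[symmetric] del: ennreal_plus)
  also have "p / (1 - 2 * \<rho> * r) * (h x0 + (\<Sum>t<n. K t)) = p / (1 - 2 * \<rho> * r) * (m x0 - Fmin)
         + c3 / (r * (1 - 2 * \<rho> * r)) * (\<Sum>t<n. \<gamma> t powr (p / (2 - p)))
         + c4 * L powr p / (r * (1 - 2 * \<rho> * r)) * (\<Sum>t<n. \<gamma> t powr p)"
  proof -
    have "p / (1 - 2 * \<rho> * r) * K t = c3 / (r * (1 - 2 * \<rho> * r)) * \<gamma> t powr (p / (2 - p))
        + c4 * L powr p / (r * (1 - 2 * \<rho> * r)) * \<gamma> t powr p" for t
    proof -
      have "p / d * (a / (r * p)) = a / (r * d)" for a d :: real using p by simp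
      from this[of "1 - 2 * \<rho> * r"] show ?thesis
        by (simp only: K_def add_divide_distrib distrib_left) simp
    qed
    then show ?thesis by (simp add: h_def distrib_left sum_distrib_left sum.distrib)
  qed
  finally show ?thesis .
qed

end

section \<open>The random output index\<close>

text \<open>Independence says that the image under \<open>Y\<close> of the measure restricted to
  \<open>A\<close> is the law of \<open>Y\<close> scaled by the probability of \<open>A\<close>.
  Equality of these measures settles all \<open>H\<close> at once.\<close>

lemma (in prob_space) nn_integral_indicator_mult_indep:
  assumes A: "A \<in> events" and Y [measurable]: "Y \<in> measurable M N"
    and H [measurable]: "H \<in> borel_measurable N"
    and indep: "\<And>B. B \<in> sets N \<Longrightarrow> prob (A \<inter> (Y -` B \<inter> space M)) = prob A * prob (Y -` B \<inter> space M)"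
  shows "(\<integral>\<^sup>+\<omega>. indicator A \<omega> * H (Y \<omega>) \<partial>M) = ennreal (prob A) * (\<integral>\<^sup>+\<omega>. H (Y \<omega>) \<partial>M)"
proof -
  have [measurable]: "A \<in> sets M" by (rule A)
  have "distr (density M (indicator A)) N Y = scale_measure (ennreal (prob A)) (distr M N Y)"
  proof (rule measure_eqI)
    fix B assume "B \<in> sets (distr (density M (indicator A)) N Y)"
    then have B [measurable]: "B \<in> sets N" by simp
    have "emeasure (distr (density M (indicator A)) N Y) B
        = (\<integral>\<^sup>+\<omega>. indicator A \<omega> * indicator (Y -` B \<inter> space M) \<omega> \<partial>M)"
      by (subst emeasure_distr) (simp_all add: emeasure_density)
    also have "\<dots> = (\<integral>\<^sup>+\<omega>. indicator (A \<inter> (Y -` B \<inter> space M)) \<omega> \<partial>M)"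
      by (simp only: indicator_inter_arith)
    also have "\<dots> = emeasure M (A \<inter> (Y -` B \<inter> space M))"
      by (rule nn_integral_indicator) measurable
    finally show "emeasure (distr (density M (indicator A)) N Y) B
        = emeasure (scale_measure (ennreal (prob A)) (distr M N Y)) B"
      by (simp add: emeasure_eq_measure indep[OF B] emeasure_distr ennreal_mult)
  qed simp
  then have "(\<integral>\<^sup>+z. H z \<partial>distr (density M (indicator A)) N Y)
      = (\<integral>\<^sup>+z. H z \<partial>scale_measure (ennreal (prob A)) (distr M N Y))" by simp
  then show ?thesis
    by (simp add: nn_integral_distr nn_integral_density nn_integral_scale_measure)
qed

context stochastic_prox_subgradient
begin

definition dist_sq :: "'a \<Rightarrow> ennreal" where
  "dist_sq x = (dist_zero (limiting_subdiff (moreau_env p r (\<lambda>y. f y + \<phi> y)) x))\<^sup>2"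

definition bound :: "nat \<Rightarrow> real" where
  "bound T = p / (1 - 2 * \<rho> * r) * (m x0 - Fmin)
     + c3 / (r * (1 - 2 * \<rho> * r)) * (\<Sum>t=0..T. \<gamma> t powr (p / (2 - p)))
     + c4 * L powr p / (r * (1 - 2 * \<rho> * r)) * (\<Sum>t=0..T. \<gamma> t powr p)"

definition major :: "nat \<Rightarrow> (nat \<Rightarrow> 'o) \<Rightarrow> ennreal" where
  "major t s = ennreal (p / (1 - 2 * \<rho> * r)) * gap t (X t s)"

lemma major_measurable [measurable]: "major t \<in> borel_measurable paths"
  unfolding major_def[abs_def] by measurable

lemma dist_sq_le_major: "ennreal (\<gamma> t) * dist_sq (X t s) \<le> major t s"
  unfolding dist_sq_def major_def by (rule dist_zero_le_gap[OF X_in])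

lemma sum_major_le: "(\<Sum>t=0..T. \<integral>\<^sup>+s. major t s \<partial>paths) \<le> ennreal (bound T)"
  using sum_gap_le[of "Suc T"] unfolding major_def bound_def
  by (simp add: atLeast0AtMost lessThan_Suc_atMost)

lemma bound_nonneg: "0 \<le> bound T"
proof -
  have "0 < 1 - 2 * \<rho> * r" using r\<rho> \<rho> by (simp add: field_simps)
  then show ?thesis
    unfolding bound_def using p r c3_nonneg c4_bounds(3) Fmin_le_m[of x0]
    by (intro add_nonneg_nonneg mult_nonneg_nonneg divide_nonneg_nonneg sum_nonneg) auto
qed

lemma prox_subgrad_eq_X: "prox_subgrad \<phi> g \<gamma> x0 \<xi> t \<omega> = X t (\<lambda>i. \<xi> i \<omega>)"
  by (induction t) (simp_all add: X_Suc step_def Let_def)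

context
  fixes P :: "'w measure" and \<xi> :: "nat \<Rightarrow> 'w \<Rightarrow> 'o"
  assumes iid: "iid_samples P \<pi> \<xi>"
begin

interpretation P: prob_space P using iid by (simp add: iid_samples_def)

lemma sample_measurable: "(\<lambda>\<omega> i. \<xi> i \<omega>) \<in> measurable P paths"
  and distr_sample: "distr P paths (\<lambda>\<omega> i. \<xi> i \<omega>) = paths"
proof -
  have ind: "P.indep_vars (\<lambda>_. \<pi>) \<xi> UNIV" using iid by (simp add: iid_samples_def)
  then have rv: "\<xi> i \<in> measurable P \<pi>" for i by (auto simp: P.indep_vars_def)
  then show "(\<lambda>\<omega> i. \<xi> i \<omega>) \<in> measurable P paths"
    by (intro measurable_PiM_single') (auto intro: measurable_space)
  have "distr P paths (\<lambda>\<omega>. \<lambda>i\<in>UNIV. \<xi> i \<omega>) = Pi\<^sub>M UNIV (\<lambda>i. distr P \<pi> (\<xi> i))"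
    using ind P.indep_vars_iff_distr_eq_PiM'[where I=UNIV and M'="\<lambda>_. \<pi>" and X=\<xi>] rv by simp
  then show "distr P paths (\<lambda>\<omega> i. \<xi> i \<omega>) = paths"
    using iid by (simp add: iid_samples_def restrict_def)
qed

lemma nn_integral_sample:
  assumes "H \<in> borel_measurable paths"
  shows "(\<integral>\<^sup>+\<omega>. H (\<lambda>i. \<xi> i \<omega>) \<partial>P) = (\<integral>\<^sup>+s. H s \<partial>paths)"
proof -
  have "(\<integral>\<^sup>+s. H s \<partial>paths) = (\<integral>\<^sup>+s. H s \<partial>distr P paths (\<lambda>\<omega> i. \<xi> i \<omega>))"
    by (simp add: distr_sample)
  also have "\<dots> = (\<integral>\<^sup>+\<omega>. H (\<lambda>i. \<xi> i \<omega>) \<partial>P)"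
    using sample_measurable assms by (intro nn_integral_distr) auto
  finally show ?thesis by simp
qed

lemma major_sample_measurable [measurable]: "(\<lambda>\<omega>. major t (\<lambda>i. \<xi> i \<omega>)) \<in> borel_measurable P"
  using measurable_compose[OF sample_measurable major_measurable] .

lemma expected_sum_le:
  "(\<integral>\<^sup>+\<omega>. (\<Sum>t=0..T. ennreal (\<gamma> t) * dist_sq (prox_subgrad \<phi> g \<gamma> x0 \<xi> t \<omega>)) \<partial>P) \<le> ennreal (bound T)"
proof -
  have "(\<integral>\<^sup>+\<omega>. (\<Sum>t=0..T. ennreal (\<gamma> t) * dist_sq (prox_subgrad \<phi> g \<gamma> x0 \<xi> t \<omega>)) \<partial>P)
      \<le> (\<integral>\<^sup>+\<omega>. (\<Sum>t=0..T. major t (\<lambda>i. \<xi> i \<omega>)) \<partial>P)"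
    unfolding prox_subgrad_eq_X by (intro nn_integral_mono sum_mono dist_sq_le_major)
  also have "\<dots> = (\<Sum>t=0..T. \<integral>\<^sup>+s. major t s \<partial>paths)"
    by (subst nn_integral_sum) (auto simp: nn_integral_sample)
  finally show ?thesis using sum_major_le order_trans by blast
qed

text \<open>On the event \<open>A t\<close> the majorant of iterate t is divided by
  \<open>\<gamma> t\<close>, and this event has probability proportional to
  \<open>\<gamma> t\<close>; the weights cancel and the bound for the sum remains.\<close>

lemma expected_output_le:
  assumes \<tau>: "output_index P \<pi> \<xi> \<gamma> T \<tau>"
  shows "(\<integral>\<^sup>+\<omega>. dist_sq (prox_subgrad \<phi> g \<gamma> x0 \<xi> (\<tau> \<omega>) \<omega>) \<partial>P) \<le> ennreal (bound T / (\<Sum>t=0..T. \<gamma> t))"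
proof -
  define A where "A t = \<tau> -` {t} \<inter> space P" for t
  have \<tau>_meas [measurable]: "\<tau> \<in> measurable P (count_space UNIV)" using \<tau> by (simp add: output_index_def)
  have A [measurable]: "A t \<in> sets P" for t unfolding A_def by measurable
  have indep: "P.prob (A t \<inter> ((\<lambda>\<omega> i. \<xi> i \<omega>) -` B \<inter> space P))
      = P.prob (A t) * P.prob ((\<lambda>\<omega> i. \<xi> i \<omega>) -` B \<inter> space P)" if "B \<in> sets paths" for t B
  proof (rule P.indep_setD)
    show "P.indep_set (sets (vimage_algebra (space P) \<tau> (count_space UNIV)))
       (sets (vimage_algebra (space P) (\<lambda>\<omega> t. \<xi> t \<omega>) paths))"
      using \<tau> by (simp add: output_index_def)
  qed (use that in \<open>auto simp: A_def intro: in_vimage_algebra\<close>)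
  have S: "0 < (\<Sum>t=0..T. \<gamma> t)" using \<gamma> by (intro sum_pos) auto
  have prob_A: "P.prob (A t) = \<gamma> t / (\<Sum>t=0..T. \<gamma> t)" if "t \<le> T" for t
  proof -
    have "A t = {\<omega> \<in> space P. \<tau> \<omega> = t}" by (auto simp: A_def)
    then show ?thesis using \<tau> that by (simp add: output_index_def)
  qed
  have "(\<integral>\<^sup>+\<omega>. dist_sq (prox_subgrad \<phi> g \<gamma> x0 \<xi> (\<tau> \<omega>) \<omega>) \<partial>P)
      \<le> (\<integral>\<^sup>+\<omega>. (\<Sum>t=0..T. indicator (A t) \<omega> * (ennreal (1 / \<gamma> t) * major t (\<lambda>i. \<xi> i \<omega>))) \<partial>P)"
  proof (rule nn_integral_mono)
    fix \<omega> assume \<omega>: "\<omega> \<in> space P"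
    define t where "t = \<tau> \<omega>"
    have t: "t \<in> {0..T}" using \<tau> \<omega> by (simp add: output_index_def t_def)
    have "dist_sq (X t (\<lambda>i. \<xi> i \<omega>)) = ennreal (1 / \<gamma> t) * (ennreal (\<gamma> t) * dist_sq (X t (\<lambda>i. \<xi> i \<omega>)))"
      using \<gamma>[of t] by (simp add: mult.assoc[symmetric] ennreal_mult'[symmetric])
    also have "\<dots> \<le> ennreal (1 / \<gamma> t) * major t (\<lambda>i. \<xi> i \<omega>)"
      by (intro mult_left_mono dist_sq_le_major) simp
    also have "\<dots> = indicator (A t) \<omega> * (ennreal (1 / \<gamma> t) * major t (\<lambda>i. \<xi> i \<omega>))"
      using \<omega> by (simp add: A_def t_def)
    also have "\<dots> \<le> (\<Sum>t=0..T. indicator (A t) \<omega> * (ennreal (1 / \<gamma> t) * major t (\<lambda>i. \<xi> i \<omega>)))"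
      using t by (intro member_le_sum) auto
    finally show "dist_sq (prox_subgrad \<phi> g \<gamma> x0 \<xi> (\<tau> \<omega>) \<omega>)
        \<le> (\<Sum>t=0..T. indicator (A t) \<omega> * (ennreal (1 / \<gamma> t) * major t (\<lambda>i. \<xi> i \<omega>)))"
      by (simp add: prox_subgrad_eq_X t_def)
  qed
  also have "\<dots> = (\<Sum>t=0..T. \<integral>\<^sup>+\<omega>. indicator (A t) \<omega> * (ennreal (1 / \<gamma> t) * major t (\<lambda>i. \<xi> i \<omega>)) \<partial>P)"
    by (rule nn_integral_sum) measurable
  also have "\<dots> = (\<Sum>t=0..T. ennreal (1 / (\<Sum>t=0..T. \<gamma> t)) * (\<integral>\<^sup>+s. major t s \<partial>paths))"
  proof (rule sum.cong[OF refl])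
    fix t assume t: "t \<in> {0..T}"
    have "(\<integral>\<^sup>+\<omega>. indicator (A t) \<omega> * (ennreal (1 / \<gamma> t) * major t (\<lambda>i. \<xi> i \<omega>)) \<partial>P)
        = ennreal (P.prob (A t)) * (\<integral>\<^sup>+\<omega>. ennreal (1 / \<gamma> t) * major t (\<lambda>i. \<xi> i \<omega>) \<partial>P)"
      using indep by (intro P.nn_integral_indicator_mult_indep[where N=paths and H="\<lambda>s. ennreal (1 / \<gamma> t) * major t s"]
          A sample_measurable) auto
    also have "\<dots> = ennreal (P.prob (A t)) * ennreal (1 / \<gamma> t) * (\<integral>\<^sup>+s. major t s \<partial>paths)"
      by (simp add: nn_integral_cmult nn_integral_sample mult.assoc)
    also have "ennreal (P.prob (A t)) * ennreal (1 / \<gamma> t) = ennreal (1 / (\<Sum>t=0..T. \<gamma> t))"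
      using prob_A[of t] t \<gamma>[of t] S
        ennreal_mult[of "\<gamma> t / (\<Sum>t=0..T. \<gamma> t)" "1 / \<gamma> t"] by simp
    finally show "(\<integral>\<^sup>+\<omega>. indicator (A t) \<omega> * (ennreal (1 / \<gamma> t) * major t (\<lambda>i. \<xi> i \<omega>)) \<partial>P)
        = ennreal (1 / (\<Sum>t=0..T. \<gamma> t)) * (\<integral>\<^sup>+s. major t s \<partial>paths)" .
  qed
  also have "\<dots> = ennreal (1 / (\<Sum>t=0..T. \<gamma> t)) * (\<Sum>t=0..T. \<integral>\<^sup>+s. major t s \<partial>paths)"
    by (simp add: sum_distrib_left)
  also have "\<dots> \<le> ennreal (1 / (\<Sum>t=0..T. \<gamma> t)) * ennreal (bound T)"
    by (intro mult_left_mono sum_major_le) simp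
  also have "\<dots> = ennreal (bound T / (\<Sum>t=0..T. \<gamma> t))"
    using S bound_nonneg[of T] by (simp add: ennreal_mult'[symmetric])
  finally show ?thesis .
qed

end

end

section \<open>Sums for the step sizes (t + 1)^(-1/p)\<close>

lemma sum_powr_neg_inverse_ge:
  fixes p :: real assumes p: "1 < p"
  shows "p / (p - 1) * ((real T + 2) powr (1 - 1 / p) - 1) \<le> (\<Sum>t=0..T. (real t + 1) powr (- 1 / p))"
proof -
  \<comment> \<open>The tangent inequality replaces comparison with an integral. Telescoping from y
    = 1 to y = T + 1 ends at T + 2.\<close>
  have step: "p / (p - 1) * ((y + 1) powr (1 - 1 / p) - y powr (1 - 1 / p)) \<le> y powr (- 1 / p)"
    if "0 < y" for y :: real
  proof -
    have "(y + 1) powr (1 - 1 / p) - y powr (1 - 1 / p) \<le> (1 - 1 / p) * y powr (- 1 / p)"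
      using powr_le_tangent[of "y + 1" y "1 - 1 / p"] that p by (simp add: field_simps)
    then have "p / (p - 1) * ((y + 1) powr (1 - 1 / p) - y powr (1 - 1 / p))
        \<le> p / (p - 1) * ((1 - 1 / p) * y powr (- 1 / p))"
      using p by (intro mult_left_mono) auto
    also have "\<dots> = y powr (- 1 / p)" using p by (simp add: field_simps)
    finally show ?thesis .
  qed
  show ?thesis
  proof (induction T)
    case 0 then show ?case using step[of 1] by simp
  next
    case (Suc T)
    then show ?case using step[of "real T + 2"] by (simp add: algebra_simps)
  qed
qed

lemma sum_inverse_le_ln: "(\<Sum>t=0..T. 1 / (real t + 1)) \<le> ln (real T + 1) + 1"
proof (induction T)
  case (Suc T)
  have "ln ((real T + 1) / (real T + 2)) \<le> (real T + 1) / (real T + 2) - 1"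
    by (rule ln_le_minus_one) simp
  also have "\<dots> = - (1 / (real T + 2))" by (simp add: field_simps)
  finally have "1 / (real T + 2) \<le> ln (real T + 2) - ln (real T + 1)" by (simp add: ln_div)
  with Suc show ?case by (simp add: algebra_simps)
qed simp

lemma sum_powr_le:
  fixes s :: real assumes s: "1 < s"
  shows "(\<Sum>t=0..T. (real t + 1) powr (- s)) \<le> s / (s - 1)"
proof -
  \<comment> \<open>Discrete form of the integral of t^(-s) over [y, y + 1], again made to
    telescope. The first summand 1 of the series is kept apart.\<close>
  have step: "(y + 1) powr (- s) \<le> (y powr (1 - s) - (y + 1) powr (1 - s)) / (s - 1)"
    if y: "0 < y" for y :: real
  proof -
    define z where "z = y / (y + 1)"
    have z: "0 < z" using y by (simp add: z_def)
    have "1 + (s - 1) * (1 - z) \<le> 1 + (1 - s) * ln z"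
      using ln_le_minus_one[OF z] s mult_left_mono[of "ln z" "z - 1" "s - 1"]
      by (simp add: algebra_simps)
    also have "\<dots> \<le> z powr (1 - s)"
      using exp_ge_add_one_self[of "(1 - s) * ln z"] z by (simp add: powr_def)
    also have "\<dots> = y powr (1 - s) / (y + 1) powr (1 - s)" using y by (simp add: z_def powr_divide)
    finally have "(1 + (s - 1) * (1 - z)) * (y + 1) powr (1 - s) \<le> y powr (1 - s)"
      using y by (simp add: pos_le_divide_eq)
    moreover have "(1 - z) * (y + 1) powr (1 - s) = (y + 1) powr (- s)"
    proof -
      have "1 - z = 1 / (y + 1)" using y by (simp add: z_def field_simps)
      moreover have "(y + 1) powr (1 - s) = (y + 1) * (y + 1) powr (- s)"
        using y powr_add[of "y + 1" 1 "- s"] by simp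
      ultimately show ?thesis using y by simp
    qed
    moreover have "(1 + (s - 1) * (1 - z)) * (y + 1) powr (1 - s)
        = (y + 1) powr (1 - s) + (s - 1) * ((1 - z) * (y + 1) powr (1 - s))"
      by (simp add: distrib_right)
    ultimately have "(s - 1) * (y + 1) powr (- s) \<le> y powr (1 - s) - (y + 1) powr (1 - s)"
      by simp
    then show ?thesis using s by (simp add: field_simps)
  qed
  have "(\<Sum>t=0..T. (real t + 1) powr (- s)) \<le> 1 + (1 - (real T + 1) powr (1 - s)) / (s - 1)"
  proof (induction T)
    case (Suc T)
    then show ?case using step[of "real T + 1"] by (simp add: algebra_simps diff_divide_distrib)
  qed simp
  also have "\<dots> \<le> 1 + 1 / (s - 1)" using s by (intro add_left_mono divide_right_mono) auto
  also have "\<dots> = s / (s - 1)" using s by (simp add: field_simps)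
  finally show ?thesis .
qed

text \<open>The minimum value is chosen before \<open>r\<close>, so one value serves both halves of
  the theorem. It is finite because f is finite at \<open>x0\<close>, a point of the domain of
  \<phi>.\<close>

lemma stochastic_prox_subgradientI:
  fixes \<phi> f :: "'a::euclidean_space \<Rightarrow> ereal"
  assumes p: "1 < p" "p < 2"
    and \<rho>: "\<rho> > 0"
    and \<phi>: "proper \<phi>" "lower_semicontinuous \<phi>" "convex_fun \<phi>"
    and f: "lower_semicontinuous f" "paraconvex \<rho> p f"
    and min_exists: "\<exists>z. \<forall>y. f z + \<phi> z \<le> f y + \<phi> y"
    and subgrad: "subgradient_oracle \<pi> U g f \<phi> p L"
    and x0: "x0 \<in> edom \<phi>"
    and \<gamma>: "\<And>t. \<gamma> t > 0"
  shows "\<exists>Fmin. (INF y. f y + \<phi> y) = ereal Fmin \<and>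
    (\<forall>r. 0 < r \<longrightarrow> r < 1 / (2 * \<rho>) \<longrightarrow> stochastic_prox_subgradient \<phi> f p r Fmin \<rho> L \<pi> U g \<gamma> x0)"
proof -
  let ?F = "\<lambda>y. f y + \<phi> y"
  interpret proper_lsc_convex \<phi> by (intro proper_lsc_convex.intro \<phi>)
  interpret \<pi>: prob_space \<pi> using subgrad by (simp add: subgradient_oracle_def)
  have f_MInf: "f x \<noteq> -\<infinity>" and \<phi>_MInf: "\<phi> x \<noteq> -\<infinity>" for x
    using f(2) \<phi>(1) by (auto simp: paraconvex_def proper_def)
  note orcl = subgrad[unfolded subgradient_oracle_def]
  have U: "open U" "edom \<phi> \<subseteq> U" and L: "0 < L"
    and g_measurable: "(\<lambda>(x, \<xi>). g x \<xi>) \<in> borel_measurable (restrict_space borel U \<Otimes>\<^sub>M \<pi>)"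
    using orcl by blast+
  have fU: "\<forall>x\<in>U. \<bar>f x\<bar> \<noteq> \<infinity>"
    using orcl by (elim conjE)
  have gU: "\<forall>x\<in>U. integrable \<pi> (g x) \<and> (\<integral>\<zeta>. g x \<zeta> \<partial>\<pi>) \<in> limiting_subdiff f x"
    using orcl by (elim conjE)
  have g_bound: "\<forall>x\<in>edom \<phi>. (\<integral>\<^sup>+\<zeta>. ennreal (norm (g x \<zeta>) powr p) \<partial>\<pi>) \<le> ennreal (L powr p)"
    using orcl by (elim conjE)
  have f_finite: "\<bar>f x\<bar> \<noteq> \<infinity>" if "x \<in> edom \<phi>" for x
    by (rule bspec[OF fU subsetD[OF U(2) that]])
  have g_integrable: "integrable \<pi> (g x)"
    and g_mean: "(\<integral>\<zeta>. g x \<zeta> \<partial>\<pi>) \<in> limiting_subdiff f x"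
    and g_moment: "(\<integral>\<^sup>+\<zeta>. ennreal (norm (g x \<zeta>) powr p) \<partial>\<pi>) \<le> ennreal (L powr p)"
    if "x \<in> edom \<phi>" for x
    using bspec[OF gU subsetD[OF U(2) that]] bspec[OF g_bound that] by blast+
  obtain z where z: "\<And>y. ?F z \<le> ?F y" using min_exists by blast
  have F_real: "?F x = ereal (real_of_ereal (?F x))" if "x \<in> edom ?F" for x
    using that f_MInf[of x] \<phi>_MInf[of x] by (cases "f x"; cases "\<phi> x") (auto simp: edom_def)
  have x0_in: "x0 \<in> edom ?F"
    using x0 f_finite[OF x0] by (cases "f x0"; cases "\<phi> x0") (auto simp: edom_def)
  have z_in: "z \<in> edom ?F"
    using z[of x0] x0_in by (auto simp: edom_def)
  define Fmin where "Fmin = real_of_ereal (?F z)"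
  have Fmin: "?F z = ereal Fmin" unfolding Fmin_def by (rule F_real[OF z_in])
  have "(INF y. ?F y) = ?F z"
    using z by (intro antisym INF_lower INF_greatest) auto
  then have INF: "(INF y. ?F y) = ereal Fmin" using Fmin by simp
  have F_ge: "Fmin \<le> real_of_ereal (?F x)" if "x \<in> edom ?F" for x
    using z[of x] F_real[OF that] Fmin by (metis ereal_less_eq(3))
  have F_closed: "closed (epi (edom ?F) (\<lambda>x. real_of_ereal (?F x)))"
  proof (rule closed_epi_liminf)
    show "?F l \<le> liminf (\<lambda>k. ?F (X k))" if "X \<longlonglongrightarrow> l" for X l
      using liminf_add_lower_semicontinuous[OF f(1) \<phi>(2) f_MInf \<phi>_MInf that] .
    show "?F x \<noteq> -\<infinity>" for x using f_MInf[of x] \<phi>_MInf[of x] by simp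
  qed
  have F_nonempty: "edom ?F \<noteq> {}" using x0_in by blast
  have subgrad_bounded: "\<exists>v\<in>limiting_subdiff f x. norm v \<le> L" if "x \<in> edom \<phi>" for x
    using g_mean[OF that]
      \<pi>.norm_expectation_le_of_powr_moment(3)[OF g_integrable[OF that] p(1) L g_moment[OF that]] by blast
  have "stochastic_prox_subgradient \<phi> f p r Fmin \<rho> L \<pi> U g \<gamma> x0" if "0 < r" "r < 1 / (2 * \<rho>)" for r
    by unfold_locales (fact that p \<rho> f F_real F_nonempty F_closed F_ge L f_finite subgrad_bounded U g_measurable
        g_integrable g_mean g_moment x0 \<gamma>)+
  with INF show ?thesis by blast
qed

theorem theorem4p1:
  fixes \<phi> f F :: "real ^ 'n \<Rightarrow> ereal"
    and g :: "real ^ 'n \<Rightarrow> 'o \<Rightarrow> real ^ 'n"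
    and \<pi> :: "'o measure" and P :: "'w measure"
    and \<xi> :: "nat \<Rightarrow> 'w \<Rightarrow> 'o"
    and U :: "(real ^ 'n) set"
    and x\<^sub>0 :: "real ^ 'n"
    and x :: "nat \<Rightarrow> 'w \<Rightarrow> real ^ 'n"
    and \<gamma> :: "nat \<Rightarrow> real"
    and p \<rho> L c\<^sub>4 :: real
  assumes p: "1 < p" "p < 2"
    and \<rho>: "\<rho> > 0"
    and \<phi>: "proper \<phi>" "lower_semicontinuous \<phi>" "convex_fun \<phi>"
    and f: "proper f" "lower_semicontinuous f" "paraconvex \<rho> p f"
    and F: "F = (\<lambda>y. f y + \<phi> y)"
    and min_exists: "\<exists>z. \<forall>y. F z \<le> F y"
    and subgrad: "subgradient_oracle \<pi> U g f \<phi> p L"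
    and samples: "iid_samples P \<pi> \<xi>"
    and x0: "x\<^sub>0 \<in> edom \<phi>"
    and steps: "\<And>t. \<gamma> t > 0"
    and x: "x = prox_subgrad \<phi> g \<gamma> x\<^sub>0 \<xi>"
    and c4: "c\<^sub>4 = 2 powr p * (1 + 2 powr (p - 1) * p)"
  shows "(\<forall>r T. 0 < r \<and> r < 1 / (2 * \<rho>) \<longrightarrow>
      (let c\<^sub>3 = 2 powr (p - 1) * r powr (- (p / (2 - p)))
                + (1 / r - 2 * \<rho>) * r powr (- (2 * (p - 1) / (2 - p)))
       in enn2ereal (\<integral>\<^sup>+\<omega>. (\<Sum>t=0..T. ennreal (\<gamma> t) *
              (dist_zero (limiting_subdiff (moreau_env p r F) (x t \<omega>)))\<^sup>2) \<partial>P)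
          \<le> ereal (p / (1 - 2 * \<rho> * r)) * (moreau_env p r F x\<^sub>0 - (INF y. F y))
            + ereal (c\<^sub>3 / (r * (1 - 2 * \<rho> * r)) * (\<Sum>t=0..T. \<gamma> t powr (p / (2 - p))))
            + ereal (c\<^sub>4 * L powr p / (r * (1 - 2 * \<rho> * r)) * (\<Sum>t=0..T. \<gamma> t powr p))))
    \<and> ((\<forall>t. \<gamma> t = (real t + 1) powr (- 1 / p)) \<longrightarrow>
      (\<forall>T \<tau>. output_index P \<pi> \<xi> \<gamma> T \<tau> \<longrightarrow>
        (let c\<^sub>5 = 2 * (p - 1);
             c\<^sub>6 = 8 * \<rho> powr (2 / (2 - p)) / p *
               (2 powr (p - 1 + 2 * p / (2 - p)) + 2 powr ((3 * p - 2) / (2 - p)));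
             c\<^sub>7 = 8 * \<rho> * (p - 1) * c\<^sub>4 / p;
             M = moreau_env p (1 / (4 * \<rho>)) F;
             D = (real T + 2) powr (1 - 1 / p) - 1
         in enn2ereal (\<integral>\<^sup>+\<omega>. (dist_zero (limiting_subdiff M (x (\<tau> \<omega>) \<omega>)))\<^sup>2 \<partial>P)
            \<le> (ereal c\<^sub>5 * (M x\<^sub>0 - (INF y. F y)) + ereal c\<^sub>6) / ereal D
              + ereal (c\<^sub>7 * L powr p * (ln (real T + 1) + 1) / D))))"
proof -
  obtain Fmin where Fmin: "(INF y. f y + \<phi> y) = ereal Fmin"
    and loc: "\<forall>r. 0 < r \<longrightarrow> r < 1 / (2 * \<rho>) \<longrightarrow>
      stochastic_prox_subgradient \<phi> f p r Fmin \<rho> L \<pi> U g \<gamma> x\<^sub>0"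
    using stochastic_prox_subgradientI[where \<gamma>=\<gamma>, OF p \<rho> \<phi> f(2,3) min_exists[unfolded F] subgrad x0 steps]
    by (elim exE conjE) (rule that)
  show ?thesis
  proof (intro conjI allI impI, goal_cases)
    case (1 r T)
    interpret stochastic_prox_subgradient \<phi> f p r Fmin \<rho> L \<pi> U g \<gamma> "x\<^sub>0"
      using loc 1 by blast
    have "enn2ereal (\<integral>\<^sup>+\<omega>. (\<Sum>t=0..T. ennreal (\<gamma> t) *
        (dist_zero (limiting_subdiff (moreau_env p r F) (x t \<omega>)))\<^sup>2) \<partial>P) \<le> ereal (bound T)"
      using expected_sum_le[OF samples, of T] enn2ereal_ennreal[OF bound_nonneg[of T]]
      unfolding less_eq_ennreal.rep_eq dist_sq_def F x by simp
    then show ?case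
      unfolding Let_def F moreau_env_eq_m Fmin
      by (simp add: bound_def c3_def c4_def c4[folded c4_def])
  next
    case (2 T \<tau>)
    define r where "r = 1 / (4 * \<rho>)"
    have r: "0 < r" "r < 1 / (2 * \<rho>)" using \<rho> by (auto simp: r_def field_simps)
    interpret stochastic_prox_subgradient \<phi> f p r Fmin \<rho> L \<pi> U g \<gamma> "x\<^sub>0"
      using loc r by blast
    define D where "D = (real T + 2) powr (1 - 1 / p) - 1"
    have "1 < (real T + 2) powr (1 - 1 / p)" using p by (intro gr_one_powr) auto
    then have D: "0 < D" by (simp add: D_def)
    have S: "p / (p - 1) * D \<le> (\<Sum>t=0..T. \<gamma> t)"
      using sum_powr_neg_inverse_ge[OF p(1), of T] 2(1) by (simp add: D_def)
    have "(\<Sum>t=0..T. \<gamma> t powr (p / (2 - p))) = (\<Sum>t=0..T. (real t + 1) powr (- (1 / (2 - p))))"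
      using 2(1) p by (simp add: powr_powr)
    also have "\<dots> \<le> (1 / (2 - p)) / (1 / (2 - p) - 1)"
      using p by (intro sum_powr_le) (simp add: field_simps)
    also have "\<dots> = 1 / (p - 1)" using p by (simp add: field_simps)
    finally have S3: "(\<Sum>t=0..T. \<gamma> t powr (p / (2 - p))) \<le> 1 / (p - 1)" .
    have "(\<Sum>t=0..T. \<gamma> t powr p) = (\<Sum>t=0..T. 1 / (real t + 1))"
    proof (rule sum.cong[OF refl])
      fix t
      have "- 1 / p * p = - 1" using p by simp
      then show "\<gamma> t powr p = 1 / (real t + 1)"
        using 2(1) by (simp only: powr_powr) (simp add: powr_minus_divide)
    qed
    then have S4: "(\<Sum>t=0..T. \<gamma> t powr p) \<le> ln (real T + 1) + 1"
      using sum_inverse_le_ln[of T] by simp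
    define c5 c6 c7 where "c5 = 2 * (p - 1)" and "c6 = 8 * \<rho> powr (2 / (2 - p)) / p *
        (2 powr (p - 1 + 2 * p / (2 - p)) + 2 powr ((3 * p - 2) / (2 - p)))"
      and "c7 = 8 * \<rho> * (p - 1) * c\<^sub>4 / p"
    \<comment> \<open>With this value both \<open>c3\<close> and \<open>c4\<close> enter
      \<open>bound\<close> with the factor 1/(r/2) = 8 \<rho>.\<close>
    have rr: "1 - 2 * \<rho> * r = 1 / 2" using \<rho> by (simp add: r_def)
    \<comment> \<open>Both summands of \<rho> \<open>c3\<close> carry the same power of \<rho>, with
      exponent 2/(2-p); the powers of 2 come from 1/r = 4 \<rho>.\<close>
    have c3_eq: "8 * \<rho> * c3 = p * c6"
    proof -
      have inv: "r powr (- q) = 2 powr (2 * q) * \<rho> powr q" for q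
      proof -
        have "r powr (- q) = (4 * \<rho>) powr q"
          using \<rho> by (simp add: r_def powr_minus_divide powr_divide)
        also have "\<dots> = 2 powr (2 * q) * \<rho> powr q"
          using \<rho> powr_powr[of 2 2 q] by (simp add: powr_mult)
        finally show ?thesis .
      qed
      have "\<rho> * \<rho> powr (p / (2 - p)) = \<rho> powr (1 + p / (2 - p))" using \<rho> by (simp add: powr_add)
      also have "1 + p / (2 - p) = 2 / (2 - p)" using p by (simp add: field_simps)
      finally have e1: "\<rho> * \<rho> powr (p / (2 - p)) = \<rho> powr (2 / (2 - p))" .
      have "\<rho> * \<rho> * \<rho> powr (2 * (p - 1) / (2 - p)) = \<rho> powr (2 + 2 * (p - 1) / (2 - p))"
        using \<rho> by (simp add: powr_add power2_eq_square)
      also have "2 + 2 * (p - 1) / (2 - p) = 2 / (2 - p)" using p by (simp add: field_simps)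
      finally have e2: "\<rho> * \<rho> * \<rho> powr (2 * (p - 1) / (2 - p)) = \<rho> powr (2 / (2 - p))" .
      have e3: "2 powr (p - 1) * 2 powr (2 * (p / (2 - p))) = (2::real) powr (p - 1 + 2 * p / (2 - p))"
        by (simp add: powr_add)
      have "2 * 2 powr (2 * (2 * (p - 1) / (2 - p))) = (2::real) powr (1 + 2 * (2 * (p - 1) / (2 - p)))"
        by (simp add: powr_add)
      also have "1 + 2 * (2 * (p - 1) / (2 - p)) = (3 * p - 2) / (2 - p)" using p by (simp add: field_simps)
      finally have e4: "2 * 2 powr (2 * (2 * (p - 1) / (2 - p))) = (2::real) powr ((3 * p - 2) / (2 - p))" .
      have "1 / r - 2 * \<rho> = 2 * \<rho>" using \<rho> by (simp add: r_def)
      then have "\<rho> * c3 = (2 powr (p - 1) * 2 powr (2 * (p / (2 - p)))) * (\<rho> * \<rho> powr (p / (2 - p)))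
          + (2 * 2 powr (2 * (2 * (p - 1) / (2 - p)))) * (\<rho> * \<rho> * \<rho> powr (2 * (p - 1) / (2 - p)))"
        unfolding c3_def inv by (simp add: algebra_simps)
      also have "\<dots> = \<rho> powr (2 / (2 - p)) *
          (2 powr (p - 1 + 2 * p / (2 - p)) + 2 powr ((3 * p - 2) / (2 - p)))"
        unfolding e1 e2 e3 e4 by (simp add: algebra_simps)
      finally show ?thesis using p by (simp add: c6_def)
    qed
    have mF: "0 \<le> m x\<^sub>0 - Fmin" using Fmin_le_m[of "x\<^sub>0"] by simp
    have c4_eq: "local.c4 = c\<^sub>4" unfolding c4_def by (rule c4[symmetric])
    have "bound T = 2 * p * (m x\<^sub>0 - Fmin) + p * c6 * (\<Sum>t=0..T. \<gamma> t powr (p / (2 - p)))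
        + 8 * \<rho> * c\<^sub>4 * L powr p * (\<Sum>t=0..T. \<gamma> t powr p)"
      unfolding bound_def rr c3_eq[symmetric] c4_eq using \<rho> by (simp add: r_def)
    also have "\<dots> \<le> 2 * p * (m x\<^sub>0 - Fmin) + p * c6 * (1 / (p - 1))
        + 8 * \<rho> * c\<^sub>4 * L powr p * (ln (real T + 1) + 1)"
      using S3 S4 p \<rho> c4_bounds(3) unfolding c4_eq
      by (intro add_mono order_refl mult_left_mono) (auto simp: c6_def)
    \<comment> \<open>The factor of the lower bound for the sum of step sizes is pulled out so that
      it cancels in the quotient; this produces the factor p - 1 in \<open>c5\<close> and
      \<open>c7\<close>.\<close>
    also have "\<dots> = p / (p - 1) * (c5 * (m x\<^sub>0 - Fmin) + c6 + c7 * L powr p * (ln (real T + 1) + 1))"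
      using p by (simp add: c5_def c7_def field_simps)
    finally have b: "bound T \<le> p / (p - 1) * (c5 * (m x\<^sub>0 - Fmin) + c6 + c7 * L powr p * (ln (real T + 1) + 1))"
      (is "_ \<le> p / (p - 1) * ?R") .
    have "0 < (\<Sum>t=0..T. \<gamma> t)" using steps by (intro sum_pos) auto
    then have "bound T / (\<Sum>t=0..T. \<gamma> t) \<le> bound T / (p / (p - 1) * D)"
      using S D p bound_nonneg[of T] by (intro divide_left_mono mult_pos_pos) auto
    also have "\<dots> \<le> (p / (p - 1) * ?R) / (p / (p - 1) * D)"
      using b D p by (intro divide_right_mono) auto
    also have "\<dots> = (c5 * (m x\<^sub>0 - Fmin) + c6) / D + c7 * L powr p * (ln (real T + 1) + 1) / D"
      using p D by (simp add: add_divide_distrib)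
    finally have le: "bound T / (\<Sum>t=0..T. \<gamma> t)
        \<le> (c5 * (m x\<^sub>0 - Fmin) + c6) / D + c7 * L powr p * (ln (real T + 1) + 1) / D" .
    have "0 \<le> bound T / (\<Sum>t=0..T. \<gamma> t)"
      using bound_nonneg[of T] less_imp_le[OF steps] by (intro divide_nonneg_nonneg sum_nonneg)
    then have "enn2ereal (\<integral>\<^sup>+\<omega>. (dist_zero (limiting_subdiff (moreau_env p r F) (x (\<tau> \<omega>) \<omega>)))\<^sup>2 \<partial>P)
        \<le> ereal (bound T / (\<Sum>t=0..T. \<gamma> t))"
      using expected_output_le[OF samples 2(2)]
      unfolding less_eq_ennreal.rep_eq dist_sq_def F x by (simp add: enn2ereal_ennreal)
    also have "\<dots> \<le> (ereal c5 * (moreau_env p r F x\<^sub>0 - (INF y. F y)) + ereal c6) / ereal D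
        + ereal (c7 * L powr p * (ln (real T + 1) + 1) / D)"
      using le D unfolding F moreau_env_eq_m Fmin by simp
    finally show ?case
      by (simp only: Let_def r_def c5_def c6_def c7_def D_def)
  qed
qed

end
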